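(* Let $\mathcal K=(D,\varsigma)$ be a selective knowledge base, $\mathbf U$ an $n$-ary $\mathcal K$-unit, $\mathbf T$ the set of all $n$-ary tuples over $\mathbb D_D$, and $\mathit{eg}(\mathbf U,\mathcal K)=(N,A,\delta)$ the expansion graph of $\mathbf U$ according to $\mathcal K$. Then: (1) $(N,A)$ is a directed acyclic graph; (2) the sets $\delta([\varphi])$ of direct instances, for $[\varphi]\in N$, form a partition of $\mathbf T$; (3) $[\mathit{core}(\mathbf U,\mathcal K)]$ is the only source node; and (4) $\delta([\mathit{core}(\mathbf U,\mathcal K)])=\mathit{ess}(\mathbf U,\mathcal K)$.
   Context: **Structures.** Fix pairwise disjoint countably infinite sets $\mathsf P$ (predicates), $\mathsf C$ (constants), $\mathsf V$ (variables). Constants and variables are terms. Each predicate has a positive arity; $\mathsf P$ contains a special unary predicate $\top$. An atom is $p(t_1,\dots,t_k)$ with $p$ a predicate of arity $k$ and $t_i$ terms. A structure is a set of atoms; its domain $\mathbb D_S$ is the set of terms occurring in its atoms. $S$ is closed under $\top$ if $\top(t)\in S$ for all $t\in\mathbb D_S$. $S$ is connected if $|S|=1$ or $S$ can be partitioned into two connected structures $S',S''$ with $\mathbb D_{S'}\cap\mathbb D_{S''}\ne\emptyset$. For a set $T$ of terms, a $T$-homomorphism from $S$ to $S'$ is a total map $h:\mathbb D_S\to\mathbb D_{S'}$ with $h(t)=t$ for $t\in T\cap\mathbb D_S$ and such that $p(t_1,\dots,t_k)\in S$ implies $p(h(t_1),\dots,h(t_k))\in S'$. **Selective knowledge bases and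 units.** A dataset is a finite nonempty structure $D$ closed under $\top$ with $\mathbb D_D\subset\mathsf C$. A summary selector $\varsigma$ is a computable function mapping a dataset $D$ and a tuple $\tau$ of constants from $\mathbb D_D$ to a dataset $\varsigma(D,\tau)\subseteq D$ (written $\varsigma(\tau)$) whose domain contains all constants of $\tau$. A selective knowledge base (SKB) is a pair $\mathcal K=(D,\varsigma)$. An $n$-ary unit is a finite nonempty set $\mathbf U$ of $n$-ary tuples of constants, $n>0$, that is proper: there are no $i\neq j$ with $\tau[i]=\tau[j]$ for all $\tau\in\mathbf U$. It is a $\mathcal K$-unit if all its constants belong to $\mathbb D_D$. **Formulas.** A formula $\varphi$ of arity $n\ge0$ is an expression $x_1,\dots,x_n\leftarrow p_1(\mathbf t_1),\dots,p_m(\mathbf t_m)$ with $m>0$ (its size $|\varphi|$), each $p_i(\mathbf t_i)$ an atom and each $x_j$ a variable (called free) occurring in some of these atoms; $\mathit{atm}(\varphi)$ is its set of atoms. $\varphi$ is open if $n\geq1$. An open $\varphi$ is nearly connected if $\mathit{atm}(\varphi)\cup\{\mathsf{free}(x_1,\dots,x_n)\}$ is connected, with $\mathsf{free}$ a fresh predicate. $\mathbb{NXL}$ is the set of nearly connected open formulas (explanations). The output $\varphi(D)$ over a dataset $D$ is the set of tuples $\langle t_1,\dots,t_n\rangle$ for which there is a $\mathsf C$-homomorphism $h$ from $\mathit{atm}(\varphi)$ to $D$ with $h(x_i)=t_i$ for all $i$. For $\mathcal K=(D,\varsigma)$, $\mathit{inst}(\varphi,\mathcal K)$ is the set of tuples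 $\tau$ (over $\mathbb D_D$) with $\tau\in\varphi(\varsigma(\tau))$. **Relations between formulas.** For $\varphi_1,\varphi_2$ with free variables $x_1,\dots,x_n$ and $y_1,\dots,y_n$, write $\varphi_1\longrightarrow\varphi_2$ if there is a $\mathsf C$-homomorphism $h$ from $\mathit{atm}(\varphi_1)$ to $\mathit{atm}(\varphi_2)$ with $h(x_i)=y_i$ for all $i$. They are equivalent, $\varphi_1\longleftrightarrow\varphi_2$, if $\varphi_1\longrightarrow\varphi_2$ and $\varphi_2\longrightarrow\varphi_1$; they are isomorphic, $\varphi_1\simeq\varphi_2$, if they are equivalent and moreover such an $h$ can be chosen bijective. $[\varphi]$ is the class of all formulas isomorphic to $\varphi$. $\mathit{core}(\varphi)$ is the formula of minimal size equivalent to $\varphi$ (unique up to isomorphism). **Definability.** $\varphi$ interprets $\mathbf U$ if $\varphi\in\mathbb{NXL}$ and $\mathit{inst}(\varphi,\mathcal K)\supseteq\mathbf U$; it defines $\mathbf U$ if moreover $\mathit{inst}(\varphi,\mathcal K)=\mathbf U$. $\mathbf U$ is definable if some formula defines it. $\mathit{ex}(\mathbf U,\mathcal K)$ is the set of all definable units $\mathbf U'\supseteq\mathbf U$, and $\mathit{ess}(\mathbf U,\mathcal K)$ is the intersection of all units in $\mathit{ex}(\mathbf U,\mathcal K)$. **Canonical and core characterization.** Let $\mathbf U=\{\tau_1,\dots,\tau_m\}$ be an $n$-ary $\mathcal K$-unit. For each sequence $\mathbf s$ of constants let $d_{\mathbf s}$ be a fresh constant (distinct for distinct $\mathbf s$).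 The direct product $\bar\tau_1\otimes\dots\otimes\bar\tau_\ell$ of $n$-ary tuples is the sequence $d_{\bar{\mathbf s}_1},\dots,d_{\bar{\mathbf s}_n}$ with $\bar{\mathbf s}_i=\bar\tau_1[i],\dots,\bar\tau_\ell[i]$; the direct product of datasets is $D_1\otimes\dots\otimes D_k=\{p(\langle\mathbf c_1\rangle\otimes\dots\otimes\langle\mathbf c_k\rangle): p(\mathbf c_1)\in D_1,\dots,p(\mathbf c_k)\in D_k\}$. Let $d_{\mathbf s_1},\dots,d_{\mathbf s_n}=\tau_1\otimes\dots\otimes\tau_m$, $\mathit{Fr}=\{d_{\mathbf s_1},\dots,d_{\mathbf s_n}\}$, $P=\varsigma(\tau_1)\otimes\dots\otimes\varsigma(\tau_m)$, and let $\mathit{Ge}$ be the set of $d_{\mathbf s}\in\mathbb D_P$ such that all entries of $\mathbf s$ are equal. For $d_{\mathbf s}\in\mathbb D_P$ let $f(d_{\mathbf s})=\{d_{\mathbf s},\mathbf s[1]\}$ if $d_{\mathbf s}\in\mathit{Fr}\cap\mathit{Ge}$, and $f(d_{\mathbf s})=\{d_{\mathbf s}\}$ otherwise. For $\alpha=p(t_1,\dots,t_k)\in P$ let $\mathit{clones}(\alpha)=\{p(c_1,\dots,c_k): c_i\in f(t_i)\}\setminus\{\alpha\}$, and $C=\bigcup_{\alpha\in P}\mathit{clones}(\alpha)$. Let $\mu$ map each $c\in\mathbb D_C\setminus\mathbb D_P$ to itself and each $d_{\mathbf s}\in\mathbb D_P$ to the variable $x_{\mathbf s}$ if $d_{\mathbf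 s}\in\mathit{Fr}$, to the variable $y_{\mathbf s}$ if $d_{\mathbf s}\notin\mathit{Fr}\cup\mathit{Ge}$, and to the constant $\mathbf s[1]$ if $d_{\mathbf s}\in\mathit{Ge}\setminus\mathit{Fr}$ (all variables $x_{\mathbf s},y_{\mathbf s}$ pairwise distinct). Let $\Phi=x_{\mathbf s_1},\dots,x_{\mathbf s_n}\leftarrow\bigwedge_{p(t_1,\dots,t_k)\in P\cup C}p(\mu(t_1),\dots,\mu(t_k))$. Then $\mathit{can}(\mathbf U,\mathcal K)$ is obtained from $\Phi$ by removing the atoms not in the maximal (under inclusion) nearly connected part of $\mathit{atm}(\Phi)$, and $\mathit{core}(\mathbf U,\mathcal K)=\mathit{core}(\mathit{can}(\mathbf U,\mathcal K))$. **Expansion graph.** $\mathit{eg}(\mathbf U,\mathcal K)=(N,A,\delta)$ where: (i) $N=\{[\mathit{core}(\mathbf U\cup\{\tau\},\mathcal K)]:\tau\in\mathbf T\}$; (ii) $A$ is the set of pairs $([\varphi_1],[\varphi_2])$ of distinct nodes such that $\varphi_2\longrightarrow\varphi_1$ and there is no $[\varphi_3]\in N\setminus\{[\varphi_1],[\varphi_2]\}$ with $\varphi_2\longrightarrow\varphi_3$ and $\varphi_3\longrightarrow\varphi_1$; (iii) $\delta([\varphi])=\mathit{inst}(\varphi,\mathcal K)\setminus\{\tau\in\mathit{inst}(\varphi',\mathcal K):([\varphi'],[\varphi])\in A\}$, the set of direct instances (this does not depend on the chosen representatives). A source is a node with no incoming arc. *)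

theory Defs
  imports "HOL-Library.Nat_Bijection" "HOL-Library.Disjoint_Sets"
begin

text \<open>
  Predicates, constants and variables range over three copies of the natural numbers. The constants
  and variables are kept apart by the constructors of \<open>trm\<close>. Atoms and structures are
  polymorphic in the predicate and in the term type, because fresh predicates and fresh
  constants are obtained by changing these types.
\<close>

type_synonym pred = nat
type_synonym const = nat
type_synonym var = nat

datatype trm = Const const | Var var

record signature =
  arity :: "pred \<Rightarrow> nat"
  top_pred :: pred

definition is_signature :: "signature \<Rightarrow> bool" where
  "is_signature sg \<longleftrightarrow> (\<forall>p. 0 < arity sg p) \<and> arity sg (top_pred sg) = 1"

type_synonym ('p, 't) atom = "'p \<times> 't list"
type_synonym ('p, 't) struct = "('p, 't) atom set"


section \<open>Structures\<close>

definition dom_of :: "('p, 't) struct \<Rightarrow> 't set" where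
  "dom_of S = (\<Union>(p, ts)\<in>S. set ts)"

definition respects_arity :: "signature \<Rightarrow> (pred, 't) struct \<Rightarrow> bool" where
  "respects_arity sg S \<longleftrightarrow> (\<forall>(p, ts)\<in>S. length ts = arity sg p)"

definition top_closed :: "signature \<Rightarrow> (pred, 't) struct \<Rightarrow> bool" where
  "top_closed sg S \<longleftrightarrow> (\<forall>t\<in>dom_of S. (top_pred sg, [t]) \<in> S)"

inductive connected_struct :: "('p, 't) struct \<Rightarrow> bool" where
  single: "connected_struct {a}"
| union: "\<lbrakk>connected_struct S'; connected_struct S''; S' \<inter> S'' = {};
           dom_of S' \<inter> dom_of S'' \<noteq> {}\<rbrakk> \<Longrightarrow> connected_struct (S' \<union> S'')"

definition is_hom :: "'t set \<Rightarrow> ('p, 't) struct \<Rightarrow> ('p, 't) struct \<Rightarrow> ('t \<Rightarrow> 't) \<Rightarrow> bool" where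
  "is_hom T S S' h \<longleftrightarrow>
     h ` dom_of S \<subseteq> dom_of S' \<and>
     (\<forall>t\<in>T \<inter> dom_of S. h t = t) \<and>
     (\<forall>(p, ts)\<in>S. (p, map h ts) \<in> S')"


section \<open>Datasets and tuples of constants\<close>

type_synonym dataset = "(pred, trm) struct"
type_synonym ctuple = "const list"

definition is_dataset :: "signature \<Rightarrow> dataset \<Rightarrow> bool" where
  "is_dataset sg D \<longleftrightarrow>
     finite D \<and> D \<noteq> {} \<and> respects_arity sg D \<and> top_closed sg D \<and> dom_of D \<subseteq> range Const"

definition consts_of :: "dataset \<Rightarrow> const set" where
  "consts_of D = {c. Const c \<in> dom_of D}"

definition tuples :: "nat \<Rightarrow> dataset \<Rightarrow> ctuple set" where
  "tuples n D = {\<tau>. length \<tau> = n \<and> set \<tau> \<subseteq> consts_of D}"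


section \<open>Computable functions\<close>

text \<open>
  Kleene's partial recursive functions; \<open>rec_eval f xs y\<close> says that \<open>f\<close> is defined on the
  arguments \<open>xs\<close> and has the value \<open>y\<close> there.
\<close>

datatype recf = Zero | Succ | Proj nat | Comp recf "recf list" | PrimRec recf recf | Mu recf

inductive rec_eval :: "recf \<Rightarrow> nat list \<Rightarrow> nat \<Rightarrow> bool" where
  zero: "rec_eval Zero xs 0"
| succ: "rec_eval Succ [x] (Suc x)"
| proj: "i < length xs \<Longrightarrow> rec_eval (Proj i) xs (xs ! i)"
| comp: "\<lbrakk>length ys = length gs; \<forall>i<length gs. rec_eval (gs ! i) xs (ys ! i); rec_eval f ys z\<rbrakk>
         \<Longrightarrow> rec_eval (Comp f gs) xs z"
| prim_0: "rec_eval f xs y \<Longrightarrow> rec_eval (PrimRec f g) (0 # xs) y"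
| prim_Suc: "\<lbrakk>rec_eval (PrimRec f g) (n # xs) y; rec_eval g (n # y # xs) z\<rbrakk>
         \<Longrightarrow> rec_eval (PrimRec f g) (Suc n # xs) z"
| mu: "\<lbrakk>rec_eval f (n # xs) 0; \<forall>i<n. \<exists>y. rec_eval f (i # xs) (Suc y)\<rbrakk> \<Longrightarrow> rec_eval (Mu f) xs n"

fun code_trm :: "trm \<Rightarrow> nat" where
  "code_trm (Const c) = sum_encode (Inl c)"
| "code_trm (Var x) = sum_encode (Inr x)"

definition code_atom :: "(pred, trm) atom \<Rightarrow> nat" where
  "code_atom a = prod_encode (fst a, list_encode (map code_trm (snd a)))"

definition code_dataset :: "dataset \<Rightarrow> nat" where
  "code_dataset D = set_encode (code_atom ` D)"


section \<open>Selective knowledge bases and units\<close>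

type_synonym selector = "dataset \<Rightarrow> ctuple \<Rightarrow> dataset"
type_synonym skb = "dataset \<times> selector"

definition computable_selector :: "signature \<Rightarrow> selector \<Rightarrow> bool" where
  "computable_selector sg sel \<longleftrightarrow>
     (\<exists>f. \<forall>D \<tau>. is_dataset sg D \<and> set \<tau> \<subseteq> consts_of D \<longrightarrow>
        rec_eval f [code_dataset D, list_encode \<tau>] (code_dataset (sel D \<tau>)))"

definition summary_selector :: "signature \<Rightarrow> selector \<Rightarrow> bool" where
  "summary_selector sg sel \<longleftrightarrow>
     computable_selector sg sel \<and>
     (\<forall>D \<tau>. is_dataset sg D \<and> set \<tau> \<subseteq> consts_of D \<longrightarrow>
        is_dataset sg (sel D \<tau>) \<and> sel D \<tau> \<subseteq> D \<and> set \<tau> \<subseteq> consts_of (sel D \<tau>))"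

definition is_skb :: "signature \<Rightarrow> skb \<Rightarrow> bool" where
  "is_skb sg K \<longleftrightarrow> is_dataset sg (fst K) \<and> summary_selector sg (snd K)"

definition summary :: "skb \<Rightarrow> ctuple \<Rightarrow> dataset" where
  "summary K \<tau> = snd K (fst K) \<tau>"

definition is_unit :: "nat \<Rightarrow> ctuple set \<Rightarrow> bool" where
  "is_unit n U \<longleftrightarrow>
     0 < n \<and> finite U \<and> U \<noteq> {} \<and> (\<forall>\<tau>\<in>U. length \<tau> = n) \<and>
     \<not> (\<exists>i<n. \<exists>j<n. i \<noteq> j \<and> (\<forall>\<tau>\<in>U. \<tau> ! i = \<tau> ! j))"

definition is_K_unit :: "skb \<Rightarrow> nat \<Rightarrow> ctuple set \<Rightarrow> bool" where
  "is_K_unit K n U \<longleftrightarrow> is_unit n U \<and> (\<forall>\<tau>\<in>U. set \<tau> \<subseteq> consts_of (fst K))"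


section \<open>Formulas\<close>

record formula =
  free_vars :: "var list"
  body :: "(pred, trm) atom list"

definition atm :: "formula \<Rightarrow> (pred, trm) struct" where
  "atm \<phi> = set (body \<phi>)"

definition fsize :: "formula \<Rightarrow> nat" where
  "fsize \<phi> = length (body \<phi>)"

definition formulas :: "signature \<Rightarrow> formula set" where
  "formulas sg = {\<phi>. body \<phi> \<noteq> [] \<and> respects_arity sg (atm \<phi>) \<and>
                     (\<forall>x\<in>set (free_vars \<phi>). Var x \<in> dom_of (atm \<phi>))}"

text \<open>The fresh predicate of the atom over the free variables is \<open>None\<close>.\<close>

definition nearly_connected :: "var list \<Rightarrow> (pred, trm) struct \<Rightarrow> bool" where
  "nearly_connected xs S \<longleftrightarrow>
     connected_struct (insert (None, map Var xs) ((\<lambda>(p, ts). (Some p, ts)) ` S))"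

definition NXL :: "signature \<Rightarrow> formula set" where
  "NXL sg = {\<phi>\<in>formulas sg. free_vars \<phi> \<noteq> [] \<and> nearly_connected (free_vars \<phi>) (atm \<phi>)}"

definition outp :: "formula \<Rightarrow> dataset \<Rightarrow> ctuple set" where
  "outp \<phi> D = {\<tau>. \<exists>h. is_hom (range Const) (atm \<phi>) D h \<and>
                       map (\<lambda>x. h (Var x)) (free_vars \<phi>) = map Const \<tau>}"

definition inst :: "formula \<Rightarrow> skb \<Rightarrow> ctuple set" where
  "inst \<phi> K = {\<tau>. set \<tau> \<subseteq> consts_of (fst K) \<and> \<tau> \<in> outp \<phi> (summary K \<tau>)}"

definition formula_hom :: "formula \<Rightarrow> formula \<Rightarrow> (trm \<Rightarrow> trm) \<Rightarrow> bool" where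
  "formula_hom \<phi>1 \<phi>2 h \<longleftrightarrow>
     is_hom (range Const) (atm \<phi>1) (atm \<phi>2) h \<and>
     map (\<lambda>x. h (Var x)) (free_vars \<phi>1) = map Var (free_vars \<phi>2)"

definition arrow :: "formula \<Rightarrow> formula \<Rightarrow> bool" where
  "arrow \<phi>1 \<phi>2 \<longleftrightarrow> (\<exists>h. formula_hom \<phi>1 \<phi>2 h)"

definition equivalent :: "formula \<Rightarrow> formula \<Rightarrow> bool" where
  "equivalent \<phi>1 \<phi>2 \<longleftrightarrow> arrow \<phi>1 \<phi>2 \<and> arrow \<phi>2 \<phi>1"

text \<open>
  The bijection is only required to be a homomorphism in one direction. For formulas that are
  isomorphic to a core, the equivalence makes its inverse a homomorphism as well.
\<close>

definition isomorphic :: "formula \<Rightarrow> formula \<Rightarrow> bool" where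
  "isomorphic \<phi>1 \<phi>2 \<longleftrightarrow>
     equivalent \<phi>1 \<phi>2 \<and>
     (\<exists>h. formula_hom \<phi>1 \<phi>2 h \<and> bij_betw h (dom_of (atm \<phi>1)) (dom_of (atm \<phi>2)))"

definition iso_class :: "signature \<Rightarrow> formula \<Rightarrow> formula set" where
  "iso_class sg \<phi> = {\<psi>\<in>formulas sg. isomorphic \<psi> \<phi>}"

text \<open>Cores are unique up to isomorphism only; \<open>core_of\<close> picks one.\<close>

definition core_of :: "signature \<Rightarrow> formula \<Rightarrow> formula" where
  "core_of sg \<phi> = (ARG_MIN fsize \<psi>. \<psi> \<in> formulas sg \<and> equivalent \<psi> \<phi>)"


section \<open>Definability\<close>

definition interprets :: "signature \<Rightarrow> skb \<Rightarrow> formula \<Rightarrow> ctuple set \<Rightarrow> bool" where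
  "interprets sg K \<phi> U \<longleftrightarrow> \<phi> \<in> NXL sg \<and> U \<subseteq> inst \<phi> K"

definition defines_unit :: "signature \<Rightarrow> skb \<Rightarrow> formula \<Rightarrow> ctuple set \<Rightarrow> bool" where
  "defines_unit sg K \<phi> U \<longleftrightarrow> interprets sg K \<phi> U \<and> inst \<phi> K = U"

definition definable :: "signature \<Rightarrow> skb \<Rightarrow> ctuple set \<Rightarrow> bool" where
  "definable sg K U \<longleftrightarrow> (\<exists>\<phi>. defines_unit sg K \<phi> U)"

definition ex_units :: "signature \<Rightarrow> ctuple set \<Rightarrow> skb \<Rightarrow> ctuple set set" where
  "ex_units sg U K = {U'. (\<exists>n. is_unit n U') \<and> definable sg K U' \<and> U \<subseteq> U'}"

definition ess :: "signature \<Rightarrow> ctuple set \<Rightarrow> skb \<Rightarrow> ctuple set" where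
  "ess sg U K = \<Inter> (ex_units sg U K)"


section \<open>Canonical characterization\<close>

text \<open>
  \<open>Fresh s\<close> is the fresh constant indexed by the sequence \<open>s\<close>; \<open>Orig c\<close> is the ordinary
  constant \<open>c\<close>.
\<close>

datatype pterm = Fresh "const list" | Orig const

text \<open>
  The \<open>i\<close>-th column of a list of equally long tuples is the sequence of their \<open>i\<close>-th entries.
\<close>

definition prod_tuple :: "ctuple list \<Rightarrow> pterm list" where
  "prod_tuple \<tau>s = map Fresh (transpose \<tau>s)"

definition prod_struct :: "dataset list \<Rightarrow> (pred, pterm) struct" where
  "prod_struct Ds =
     {(p, prod_tuple cs) | p cs. list_all2 (\<lambda>c D. (p, map Const c) \<in> D) cs Ds}"

definition Fr :: "ctuple list \<Rightarrow> pterm set" where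
  "Fr \<tau>s = set (prod_tuple \<tau>s)"

definition Pr :: "skb \<Rightarrow> ctuple list \<Rightarrow> (pred, pterm) struct" where
  "Pr K \<tau>s = prod_struct (map (summary K) \<tau>s)"

definition Ge :: "skb \<Rightarrow> ctuple list \<Rightarrow> pterm set" where
  "Ge K \<tau>s = {Fresh s | s. Fresh s \<in> dom_of (Pr K \<tau>s) \<and> (\<forall>a\<in>set s. \<forall>b\<in>set s. a = b)}"

fun term_clones :: "skb \<Rightarrow> ctuple list \<Rightarrow> pterm \<Rightarrow> pterm set" where
  "term_clones K \<tau>s (Fresh s) =
     (if Fresh s \<in> Fr \<tau>s \<inter> Ge K \<tau>s then {Fresh s, Orig (hd s)} else {Fresh s})"
| "term_clones K \<tau>s (Orig c) = {Orig c}"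

definition clones :: "skb \<Rightarrow> ctuple list \<Rightarrow> (pred, pterm) atom \<Rightarrow> (pred, pterm) struct" where
  "clones K \<tau>s \<alpha> =
     {(fst \<alpha>, cs) | cs. list_all2 (\<lambda>c t. c \<in> term_clones K \<tau>s t) cs (snd \<alpha>)} - {\<alpha>}"

definition Cl :: "skb \<Rightarrow> ctuple list \<Rightarrow> (pred, pterm) struct" where
  "Cl K \<tau>s = (\<Union>\<alpha>\<in>Pr K \<tau>s. clones K \<tau>s \<alpha>)"

definition xvar :: "const list \<Rightarrow> var" where
  "xvar s = sum_encode (Inl (list_encode s))"

definition yvar :: "const list \<Rightarrow> var" where
  "yvar s = sum_encode (Inr (list_encode s))"

fun mu :: "skb \<Rightarrow> ctuple list \<Rightarrow> pterm \<Rightarrow> trm" where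
  "mu K \<tau>s (Orig c) = Const c"
| "mu K \<tau>s (Fresh s) =
     (if Fresh s \<in> Fr \<tau>s then Var (xvar s)
      else if Fresh s \<in> Ge K \<tau>s then Const (hd s)
      else Var (yvar s))"

definition enum :: "'a set \<Rightarrow> 'a list" where
  "enum S = (SOME xs. distinct xs \<and> set xs = S)"

definition Phi :: "skb \<Rightarrow> ctuple list \<Rightarrow> formula" where
  "Phi K \<tau>s =
     \<lparr>free_vars = map xvar (transpose \<tau>s),
      body = enum ((\<lambda>(p, ts). (p, map (mu K \<tau>s) ts)) ` (Pr K \<tau>s \<union> Cl K \<tau>s))\<rparr>"

definition max_nc_part :: "var list \<Rightarrow> (pred, trm) struct \<Rightarrow> (pred, trm) struct" where
  "max_nc_part xs S =
     (THE M. M \<subseteq> S \<and> nearly_connected xs M \<and>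
             (\<forall>M'. M' \<subseteq> S \<and> nearly_connected xs M' \<and> M \<subseteq> M' \<longrightarrow> M' = M))"

text \<open>
  The order in which the tuples of the unit are listed affects \<open>can\<close> only up to isomorphism.
\<close>

definition can :: "ctuple set \<Rightarrow> skb \<Rightarrow> formula" where
  "can U K =
     (let \<Phi> = Phi K (enum U)
      in \<Phi>\<lparr>body := filter (\<lambda>a. a \<in> max_nc_part (free_vars \<Phi>) (atm \<Phi>)) (body \<Phi>)\<rparr>)"

definition core_char :: "signature \<Rightarrow> ctuple set \<Rightarrow> skb \<Rightarrow> formula" where
  "core_char sg U K = core_of sg (can U K)"


section \<open>Expansion graph\<close>

definition eg_nodes :: "signature \<Rightarrow> nat \<Rightarrow> ctuple set \<Rightarrow> skb \<Rightarrow> formula set set" where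
  "eg_nodes sg n U K = {iso_class sg (core_char sg (U \<union> {\<tau>}) K) | \<tau>. \<tau> \<in> tuples n (fst K)}"

definition eg_arcs :: "signature \<Rightarrow> formula set set \<Rightarrow> (formula set \<times> formula set) set" where
  "eg_arcs sg N =
     {(iso_class sg \<phi>1, iso_class sg \<phi>2) | \<phi>1 \<phi>2.
        \<phi>1 \<in> formulas sg \<and> \<phi>2 \<in> formulas sg \<and>
        iso_class sg \<phi>1 \<in> N \<and> iso_class sg \<phi>2 \<in> N \<and>
        iso_class sg \<phi>1 \<noteq> iso_class sg \<phi>2 \<and> arrow \<phi>2 \<phi>1 \<and>
        \<not> (\<exists>\<phi>3\<in>formulas sg.
              iso_class sg \<phi>3 \<in> N - {iso_class sg \<phi>1, iso_class sg \<phi>2} \<and>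
              arrow \<phi>2 \<phi>3 \<and> arrow \<phi>3 \<phi>1)}"

text \<open>
  All formulas in a node have the same instances, so the choice of a representative is immaterial.
\<close>

definition direct_instances ::
  "signature \<Rightarrow> skb \<Rightarrow> (formula set \<times> formula set) set \<Rightarrow> formula set \<Rightarrow> ctuple set" where
  "direct_instances sg K A X =
     inst (SOME \<phi>. \<phi> \<in> X) K -
     {\<tau>. \<exists>\<phi>'\<in>formulas sg. \<tau> \<in> inst \<phi>' K \<and> (iso_class sg \<phi>', X) \<in> A}"

definition expansion_graph ::
  "signature \<Rightarrow> nat \<Rightarrow> ctuple set \<Rightarrow> skb \<Rightarrow>
   formula set set \<times> (formula set \<times> formula set) set \<times> (formula set \<Rightarrow> ctuple set)" where
  "expansion_graph sg n U K =
     (let N = eg_nodes sg n U K; A = eg_arcs sg N in (N, A, direct_instances sg K A))"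

definition directed_acyclic_graph :: "'v set \<Rightarrow> ('v \<times> 'v) set \<Rightarrow> bool" where
  "directed_acyclic_graph N A \<longleftrightarrow> finite N \<and> A \<subseteq> N \<times> N \<and> acyclic A"

definition sources :: "'v set \<Rightarrow> ('v \<times> 'v) set \<Rightarrow> 'v set" where
  "sources N A = {v\<in>N. \<not> (\<exists>u. (u, v) \<in> A)}"

end

theory Submission
  imports Defs
begin

text \<open>
  The canonical formula of a unit \<open>U\<close> describes the direct product of the summaries of its tuples.
  Its projections show that it interprets \<open>U\<close>, and the universal property of the product (refined
  by the clones, which take care of constants) shows that every explanation interpreting \<open>U\<close>
  maps into it. Since homomorphisms reverse the inclusion of instances, a tuple \<open>\<sigma>\<close> is an instance
  of \<open>core(U \<union> {\<tau>})\<close> iff \<open>core(U \<union> {\<tau>}) \<longrightarrow> core(U \<union> {\<sigma>})\<close>. Equivalent formulas of minimal size are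
  isomorphic, so the nodes are partially ordered by \<open>\<longrightarrow>\<close> and the arcs are the covering relation of
  this order. A finite order is generated by its covering relation, hence the direct instances of
  the node of \<open>\<tau>\<close> are exactly the tuples with the same node as \<open>\<tau>\<close>; these fibres partition \<open>T\<close>. The
  tuples of \<open>U\<close> all have the node \<open>[core(U)]\<close>, to which every node maps and
  which is therefore the only source, and its instances form the smallest definable unit containing \<open>U\<close>.
\<close>

section \<open>Connectedness\<close>

lemma dom_of_insert [simp]: "dom_of (insert a S) = set (snd a) \<union> dom_of S"
  by (auto simp: dom_of_def split: prod.splits)

lemma dom_of_empty [simp]: "dom_of {} = {}"
  by (simp add: dom_of_def)

lemma dom_of_Un [simp]: "dom_of (S \<union> S') = dom_of S \<union> dom_of S'"
  by (auto simp: dom_of_def)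

lemma dom_of_mono: "S \<subseteq> S' \<Longrightarrow> dom_of S \<subseteq> dom_of S'"
  by (auto simp: dom_of_def)

lemma dom_ofI: "(p, ts) \<in> S \<Longrightarrow> t \<in> set ts \<Longrightarrow> t \<in> dom_of S"
  by (auto simp: dom_of_def)

lemma dom_of_image: "dom_of ((\<lambda>(p, ts). (f p, map g ts)) ` S) = g ` dom_of S"
  unfolding dom_of_def image_UN by (simp add: case_prod_unfold)

lemma finite_dom_of: "finite S \<Longrightarrow> finite (dom_of S)"
  by (auto simp: dom_of_def)

text \<open>Rule \<open>union\<close> joins disjoint parts only; this removes the disjointness. In
  the induction on \<open>S\<close>, the set \<open>C\<close> first absorbs whichever half of
  \<open>S\<close> shares a term with it. The other half then shares a term with the enlarged set,
  because the two halves share one.\<close>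

lemma connected_struct_Un:
  assumes "connected_struct S" "connected_struct C" "dom_of C \<inter> dom_of S \<noteq> {}"
  shows "connected_struct (C \<union> S)"
  using assms
proof (induction arbitrary: C rule: connected_struct.induct)
  case (single a)
  show ?case
  proof (cases "a \<in> C")
    case True
    then have "C \<union> {a} = C" by blast
    with single show ?thesis by simp
  next
    case False
    with single show ?thesis
      by (intro connected_struct.union connected_struct.single) auto
  qed
next
  case (union S' S'')
  consider "dom_of C \<inter> dom_of S' \<noteq> {}" | "dom_of C \<inter> dom_of S'' \<noteq> {}"
    using union.prems by auto
  then show ?case
  proof cases
    case 1
    then have "connected_struct (C \<union> S')" using union by blast
    moreover have "dom_of (C \<union> S') \<inter> dom_of S'' \<noteq> {}" using union.hyps by auto
    ultimately have "connected_struct ((C \<union> S') \<union> S'')" by (rule union.IH(2))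
    then show ?thesis by (simp add: Un_assoc)
  next
    case 2
    then have "connected_struct (C \<union> S'')" using union by blast
    moreover have "dom_of (C \<union> S'') \<inter> dom_of S' \<noteq> {}" using union.hyps by auto
    ultimately have "connected_struct ((C \<union> S'') \<union> S')" by (rule union.IH(1))
    then show ?thesis by (simp add: Un_ac)
  qed
qed

text \<open>A map of terms may merge atoms, so the images of disjoint parts can overlap. The union
  of connected structures must therefore be available without disjointness.\<close>

lemma connected_struct_image:
  "connected_struct S \<Longrightarrow> connected_struct ((\<lambda>(p, ts). (p, map g ts)) ` S)"
proof (induction rule: connected_struct.induct)
  case (single a)
  then show ?case by (cases a) (simp add: connected_struct.single)
next
  case (union S' S'')
  then show ?case
    by (subst image_Un, intro connected_struct_Un) (auto simp: dom_of_image[of "\<lambda>p. p"])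
qed

text \<open>Both structures are extended by the same atom over \<open>xs\<close>, and since
  \<open>xs\<close> is nonempty this atom provides a shared term.\<close>

lemma nearly_connected_Un:
  assumes "xs \<noteq> []" "nearly_connected xs S" "nearly_connected xs S'"
  shows "nearly_connected xs (S \<union> S')"
proof -
  let ?m = "\<lambda>S. insert (None, map Var xs) ((\<lambda>(p, ts). (Some p, ts)) ` S)"
  have "connected_struct (?m S \<union> ?m S')"
    using assms unfolding nearly_connected_def by (intro connected_struct_Un) (auto simp: neq_Nil_conv)
  moreover have "?m S \<union> ?m S' = ?m (S \<union> S')" by auto
  ultimately show ?thesis by (simp add: nearly_connected_def)
qed

text \<open>As \<open>g\<close> carries \<open>xs\<close> to \<open>ys\<close>, it maps the
  additional atom over the free variables to the corresponding one, so the image of the extended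
  structure is again an extended structure.\<close>

lemma nearly_connected_image:
  assumes "nearly_connected xs S" "map (\<lambda>x. g (Var x)) xs = map Var ys"
  shows "nearly_connected ys ((\<lambda>(p, ts). (p, map g ts)) ` S)"
proof -
  have "(\<lambda>(p, ts). (p, map g ts)) ` insert (None, map Var xs) ((\<lambda>(p, ts). (Some p, ts)) ` S)
      = insert (None, map Var ys)
          ((\<lambda>(p, ts). (Some p, ts)) ` (\<lambda>(p, ts). (p, map g ts)) ` S)"
    using assms(2) by (simp add: image_image case_prod_unfold comp_def)
  with connected_struct_image[of _ g] assms(1) show ?thesis
    unfolding nearly_connected_def by metis
qed

lemma nearly_connected_empty: "nearly_connected xs {}"
  by (simp add: nearly_connected_def connected_struct.single)

lemma nearly_connected_single:
  assumes "x \<in> set xs" "Var x \<in> set ts"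
  shows "nearly_connected xs {(p, ts)}"
proof -
  have "connected_struct ({(None, map Var xs)} \<union> {(Some p, ts)})"
    using assms by (intro connected_struct.union connected_struct.single) auto
  then show ?thesis by (simp add: nearly_connected_def insert_commute)
qed

text \<open>This justifies the definite description: a maximal element exists because
  \<open>S\<close> is finite and the empty set is nearly connected, and closure under union turns it
  into the greatest one.\<close>

lemma max_nc_part:
  assumes "finite S" "xs \<noteq> []"
  shows max_nc_part_subset: "max_nc_part xs S \<subseteq> S"
    and nearly_connected_max_nc_part: "nearly_connected xs (max_nc_part xs S)"
    and max_nc_part_greatest: "\<And>M. M \<subseteq> S \<Longrightarrow> nearly_connected xs M \<Longrightarrow> M \<subseteq> max_nc_part xs S"
proof -
  let ?F = "{M. M \<subseteq> S \<and> nearly_connected xs M}"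
  have "finite ?F" using assms(1) by simp
  moreover have "{} \<in> ?F" by (simp add: nearly_connected_empty)
  ultimately obtain G where G: "G \<in> ?F" "\<And>M. M \<in> ?F \<Longrightarrow> G \<subseteq> M \<Longrightarrow> G = M"
    by (metis (no_types, lifting) empty_iff finite_has_maximal)
  have great: "M \<subseteq> G" if "M \<subseteq> S" "nearly_connected xs M" for M
    using G(2)[of "G \<union> M"] G(1) that nearly_connected_Un[OF assms(2), of G M] by blast
  have "max_nc_part xs S = G"
    unfolding max_nc_part_def
  proof (rule the_equality)
    show "G \<subseteq> S \<and> nearly_connected xs G \<and>
        (\<forall>M'. M' \<subseteq> S \<and> nearly_connected xs M' \<and> G \<subseteq> M' \<longrightarrow> M' = G)"
      using G by blast
  next
    fix M
    assume "M \<subseteq> S \<and> nearly_connected xs M \<and>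
        (\<forall>M'. M' \<subseteq> S \<and> nearly_connected xs M' \<and> M \<subseteq> M' \<longrightarrow> M' = M)"
    then show "M = G" using great G(1) by blast
  qed
  then show "max_nc_part xs S \<subseteq> S" "nearly_connected xs (max_nc_part xs S)"
    using G(1) by simp_all
  show "M \<subseteq> max_nc_part xs S" if "M \<subseteq> S" "nearly_connected xs M" for M
    using great[OF that] \<open>max_nc_part xs S = G\<close> by simp
qed


section \<open>Homomorphisms, equivalence and cores\<close>

text \<open>Every term of the domain occurs in an atom, so preservation of atoms already sends the
  domain of \<open>S\<close> into that of \<open>S'\<close>.\<close>

lemma is_homI:
  assumes "\<And>t. t \<in> T \<inter> dom_of S \<Longrightarrow> h t = t" "\<And>p ts. (p, ts) \<in> S \<Longrightarrow> (p, map h ts) \<in> S'"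
  shows "is_hom T S S' h"
proof -
  have "h t \<in> dom_of S'" if "t \<in> dom_of S" for t
  proof -
    from that obtain p ts where p: "(p, ts) \<in> S" "t \<in> set ts" unfolding dom_of_def by blast
    from assms(2)[OF p(1)] show ?thesis by (rule dom_ofI) (use p(2) in simp)
  qed
  with assms show ?thesis unfolding is_hom_def by blast
qed

lemma is_hom_mono: "is_hom T S' S'' h \<Longrightarrow> S \<subseteq> S' \<Longrightarrow> is_hom T S S'' h"
  by (rule is_homI) (use dom_of_mono[of S S'] in \<open>auto simp: is_hom_def\<close>)

lemma is_hom_comp:
  assumes "is_hom T S S' h" "is_hom T S' S'' g"
  shows "is_hom T S S'' (g \<circ> h)"
proof (rule is_homI)
  fix t assume t: "t \<in> T \<inter> dom_of S"
  then have "h t = t" "t \<in> dom_of S'" using assms(1) unfolding is_hom_def by force+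
  then show "(g \<circ> h) t = t" using t assms(2) by (simp add: is_hom_def)
next
  fix p ts assume "(p, ts) \<in> S"
  then have "(p, map h ts) \<in> S'" using assms(1) by (auto simp: is_hom_def)
  then have "(p, map g (map h ts)) \<in> S''" using assms(2) by (fastforce simp: is_hom_def)
  then show "(p, map (g \<circ> h) ts) \<in> S''" by simp
qed

lemma is_hom_id: "is_hom T S S (\<lambda>t. t)"
  by (simp add: is_hom_def)

lemma formula_hom_comp:
  assumes "formula_hom \<phi> \<psi> h" "formula_hom \<psi> \<chi> g"
  shows "formula_hom \<phi> \<chi> (g \<circ> h)"
proof -
  have "map (\<lambda>x. (g \<circ> h) (Var x)) (free_vars \<phi>) = map g (map (\<lambda>x. h (Var x)) (free_vars \<phi>))"
    by simp
  also have "\<dots> = map (\<lambda>x. g (Var x)) (free_vars \<psi>)"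
    using assms(1) by (simp add: formula_hom_def)
  finally show ?thesis
    using assms is_hom_comp by (auto simp: formula_hom_def)
qed

lemma arrow_refl: "arrow \<phi> \<phi>"
  unfolding arrow_def formula_hom_def using is_hom_id by blast

lemma arrow_trans: "arrow \<phi> \<psi> \<Longrightarrow> arrow \<psi> \<chi> \<Longrightarrow> arrow \<phi> \<chi>"
  unfolding arrow_def using formula_hom_comp by blast

lemma equivalent_sym: "equivalent \<phi> \<psi> \<Longrightarrow> equivalent \<psi> \<phi>"
  by (simp add: equivalent_def)

lemma equivalent_trans: "equivalent \<phi> \<psi> \<Longrightarrow> equivalent \<psi> \<chi> \<Longrightarrow> equivalent \<phi> \<chi>"
  unfolding equivalent_def using arrow_trans by blast

lemma isomorphic_refl: "isomorphic \<phi> \<phi>"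
proof -
  have "formula_hom \<phi> \<phi> (\<lambda>t. t)" by (simp add: formula_hom_def is_hom_id)
  moreover have "bij_betw (\<lambda>t. t) (dom_of (atm \<phi>)) (dom_of (atm \<phi>))" by (simp add: bij_betw_def)
  ultimately show ?thesis unfolding isomorphic_def equivalent_def using arrow_refl by blast
qed

lemma isomorphic_trans: "isomorphic \<phi> \<psi> \<Longrightarrow> isomorphic \<psi> \<chi> \<Longrightarrow> isomorphic \<phi> \<chi>"
  unfolding isomorphic_def by (meson bij_betw_trans equivalent_trans formula_hom_comp)

text \<open>A witness for an instance of \<psi>, composed with the homomorphism from \<phi> to
  \<psi>, is a witness for \<phi>.\<close>

lemma arrow_inst_antimono:
  assumes "arrow \<phi> \<psi>"
  shows "inst \<psi> K \<subseteq> inst \<phi> K"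
proof
  fix \<tau> assume \<tau>: "\<tau> \<in> inst \<psi> K"
  from assms obtain h where h: "formula_hom \<phi> \<psi> h" by (auto simp: arrow_def)
  from \<tau> obtain g where g: "is_hom (range Const) (atm \<psi>) (summary K \<tau>) g"
    "map (\<lambda>x. g (Var x)) (free_vars \<psi>) = map Const \<tau>" by (auto simp: inst_def outp_def)
  have "map (\<lambda>x. (g \<circ> h) (Var x)) (free_vars \<phi>) = map g (map (\<lambda>x. h (Var x)) (free_vars \<phi>))"
    by simp
  also have "\<dots> = map Const \<tau>" using h g(2) by (simp add: formula_hom_def comp_def)
  finally have "map (\<lambda>x. (g \<circ> h) (Var x)) (free_vars \<phi>) = map Const \<tau>" .
  moreover have "is_hom (range Const) (atm \<phi>) (summary K \<tau>) (g \<circ> h)"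
    using h g(1) by (intro is_hom_comp) (auto simp: formula_hom_def)
  moreover have "set \<tau> \<subseteq> consts_of (fst K)" using \<tau> by (simp add: inst_def)
  ultimately show "\<tau> \<in> inst \<phi> K" unfolding inst_def outp_def by blast
qed

lemma equivalent_inst: "equivalent \<phi> \<psi> \<Longrightarrow> inst \<phi> K = inst \<psi> K"
  by (simp add: equivalent_def arrow_inst_antimono subset_antisym)

lemma inst_length:
  assumes "\<tau> \<in> inst \<phi> K"
  shows "length \<tau> = length (free_vars \<phi>)"
proof -
  from assms obtain h where "map (\<lambda>x. h (Var x)) (free_vars \<phi>) = map Const \<tau>"
    unfolding inst_def outp_def by blast
  then have "length (map (\<lambda>x. h (Var x)) (free_vars \<phi>)) = length (map Const \<tau>)" by (rule arg_cong)
  then show ?thesis by simp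
qed

section \<open>Formulas of minimal size and the uniqueness of cores\<close>

definition minimal_formula :: "signature \<Rightarrow> formula \<Rightarrow> bool" where
  "minimal_formula sg \<phi> \<longleftrightarrow> \<phi> \<in> formulas sg \<and>
     (\<forall>\<psi>\<in>formulas sg. equivalent \<psi> \<phi> \<longrightarrow> fsize \<phi> \<le> fsize \<psi>)"

text \<open>The formula itself is a candidate, so the minimum is attained. By transitivity, being
  equivalent to the core and being equivalent to \<phi> select the same competitors.\<close>

lemma core_of:
  assumes "\<phi> \<in> formulas sg"
  shows equivalent_core_of: "equivalent (core_of sg \<phi>) \<phi>"
    and minimal_core_of: "minimal_formula sg (core_of sg \<phi>)"
proof -
  let ?P = "\<lambda>\<psi>. \<psi> \<in> formulas sg \<and> equivalent \<psi> \<phi>"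
  have "?P \<phi>" using assms arrow_refl by (simp add: equivalent_def)
  then have *: "?P (core_of sg \<phi>)" unfolding core_of_def by (rule arg_min_natI)
  have "fsize (core_of sg \<phi>) \<le> fsize \<psi>" if "?P \<psi>" for \<psi>
    unfolding core_of_def by (rule arg_min_nat_le) (rule that)
  note * = * this
  then show "equivalent (core_of sg \<phi>) \<phi>" by blast
  show "minimal_formula sg (core_of sg \<phi>)"
    using * unfolding minimal_formula_def by (meson equivalent_trans)
qed

text \<open>The image of a homomorphism between equivalent formulas is equivalent to both of them,
  so minimality forces it to be the whole target.\<close>

lemma minimal_formula_hom_surj:
  assumes min: "minimal_formula sg \<psi>" and h: "formula_hom \<phi> \<psi> h" and "arrow \<psi> \<phi>"
    and "\<phi> \<in> formulas sg"
  shows "(\<lambda>(p, ts). (p, map h ts)) ` atm \<phi> = atm \<psi>"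
proof -
  let ?I = "(\<lambda>(p, ts). (p, map h ts)) ` atm \<phi>"
  have sub: "?I \<subseteq> atm \<psi>" using h by (auto simp: formula_hom_def is_hom_def)
  have fin: "finite ?I" by (simp add: atm_def)
  \<comment> \<open>Listing the image without repetition makes the size of \<chi> equal to the
    number of its atoms.\<close>
  obtain as where as: "set as = ?I" "distinct as" using finite_distinct_list[OF fin] by blast
  define \<chi> where "\<chi> = \<lparr>free_vars = free_vars \<psi>, body = as\<rparr>"
  have atm\<chi>: "atm \<chi> = ?I" by (simp add: \<chi>_def atm_def as)
  have h': "formula_hom \<phi> \<chi> h"
    unfolding formula_hom_def atm\<chi>
  proof
    show "is_hom (range Const) (atm \<phi>) ?I h"
      using h by (intro is_homI) (auto simp: formula_hom_def is_hom_def)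
    show "map (\<lambda>x. h (Var x)) (free_vars \<phi>) = map Var (free_vars \<chi>)"
      using h by (simp add: \<chi>_def formula_hom_def)
  qed
  have "formula_hom \<chi> \<psi> (\<lambda>t. t)"
    unfolding formula_hom_def atm\<chi>
    using is_hom_mono[OF is_hom_id sub] by (simp add: \<chi>_def)
  then have "arrow \<chi> \<psi>" unfolding arrow_def by blast
  moreover have "arrow \<phi> \<chi>" using h' unfolding arrow_def by blast
  ultimately have "equivalent \<chi> \<psi>"
    using assms(3) arrow_trans unfolding equivalent_def by blast
  moreover have "\<chi> \<in> formulas sg"
  proof -
    have "Var x \<in> dom_of ?I" if "x \<in> set (free_vars \<psi>)" for x
    proof -
      have "Var x \<in> (\<lambda>x. h (Var x)) ` set (free_vars \<phi>)"
        using h that unfolding formula_hom_def by (metis imageI list.set_map)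
      then show ?thesis
        using assms(4) unfolding dom_of_image[of "\<lambda>p. p", simplified] formulas_def by auto
    qed
    moreover have "as \<noteq> []" using as assms(4) by (auto simp: formulas_def atm_def)
    moreover have "respects_arity sg ?I"
      using assms(4) by (auto simp: formulas_def respects_arity_def)
    ultimately show ?thesis by (simp add: formulas_def atm\<chi>) (simp add: \<chi>_def)
  qed
  ultimately have "fsize \<psi> \<le> fsize \<chi>" using min by (simp add: minimal_formula_def)
  \<comment> \<open>The size of \<psi> is at least its number of atoms, since a body may list an
    atom twice.\<close>
  then have "card (atm \<psi>) \<le> card ?I"
    using as card_length[of "body \<psi>"] by (simp add: fsize_def \<chi>_def atm_def flip: distinct_card)
  with sub show ?thesis by (metis List.finite_set atm_def card_seteq)
qed

text \<open>Homomorphisms in both directions are onto on terms. The two finite term sets thus have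
  equal cardinality, and a surjection between them is injective.\<close>

lemma minimal_formula_hom_bij:
  assumes "minimal_formula sg \<phi>" "minimal_formula sg \<psi>" "formula_hom \<phi> \<psi> h" "arrow \<psi> \<phi>"
  shows "bij_betw h (dom_of (atm \<phi>)) (dom_of (atm \<psi>))"
proof -
  have surj: "h ` dom_of (atm \<phi>) = dom_of (atm \<psi>)"
    if "minimal_formula sg \<phi>" "minimal_formula sg \<psi>" "formula_hom \<phi> \<psi> h" "arrow \<psi> \<phi>" for \<phi> \<psi> h
    using minimal_formula_hom_surj[OF that(2,3,4)] that(1) dom_of_image[of "\<lambda>p. p" h "atm \<phi>"]
    unfolding minimal_formula_def by simp
  obtain g where "formula_hom \<psi> \<phi> g" using assms(4) by (auto simp: arrow_def)
  then have "g ` dom_of (atm \<psi>) = dom_of (atm \<phi>)"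
    using surj assms unfolding arrow_def by blast
  moreover have fin: "finite (dom_of (atm \<chi>))" for \<chi> by (simp add: finite_dom_of atm_def)
  ultimately have "card (dom_of (atm \<phi>)) \<le> card (dom_of (atm \<psi>))"
    by (metis card_image_le)
  moreover have "h ` dom_of (atm \<phi>) = dom_of (atm \<psi>)" by (rule surj[OF assms])
  ultimately show ?thesis
    using fin card_image_le[OF fin, of h \<phi>] by (simp add: bij_betw_def eq_card_imp_inj_on)
qed

lemma minimal_equivalent_imp_isomorphic:
  assumes "minimal_formula sg \<phi>" "minimal_formula sg \<psi>" "equivalent \<phi> \<psi>"
  shows "isomorphic \<phi> \<psi>"
proof -
  obtain h where "formula_hom \<phi> \<psi> h" using assms by (auto simp: equivalent_def arrow_def)
  with assms minimal_formula_hom_bij show ?thesis unfolding isomorphic_def equivalent_def by blast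
qed

text \<open>A class contains formulas over the signature only; membership of \<phi> in
  \<open>formulas sg\<close> places it in its own class.\<close>

lemma iso_class_imp_equivalent:
  assumes "\<phi> \<in> formulas sg" "iso_class sg \<phi> = iso_class sg \<psi>"
  shows "equivalent \<phi> \<psi>"
proof -
  have "\<phi> \<in> iso_class sg \<phi>" using assms(1) isomorphic_refl by (simp add: iso_class_def)
  then show ?thesis using assms(2) by (auto simp: iso_class_def isomorphic_def)
qed

text \<open>For minimal formulas, equality of nodes reduces to equivalence. Isomorphism is obtained
  separately in each direction, since its definition asks for a bijective homomorphism one way
  only.\<close>

lemma minimal_iso_class_eq_iff:
  assumes "minimal_formula sg \<phi>" "minimal_formula sg \<psi>"
  shows "iso_class sg \<phi> = iso_class sg \<psi> \<longleftrightarrow> equivalent \<phi> \<psi>"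
proof
  assume "iso_class sg \<phi> = iso_class sg \<psi>"
  then show "equivalent \<phi> \<psi>"
    using assms(1) iso_class_imp_equivalent unfolding minimal_formula_def by blast
next
  assume "equivalent \<phi> \<psi>"
  then have "isomorphic \<phi> \<psi>" "isomorphic \<psi> \<phi>"
    using assms minimal_equivalent_imp_isomorphic equivalent_sym by blast+
  then show "iso_class sg \<phi> = iso_class sg \<psi>"
    unfolding iso_class_def using isomorphic_trans by blast
qed


section \<open>The canonical characterization\<close>

lemma transpose_columns:
  assumes "xss \<noteq> []" "\<forall>xs\<in>set xss. length xs = k"
  shows "transpose xss = map (\<lambda>i. map (\<lambda>xs. xs ! i) xss) [0..<k]"
proof -
  have "transpose xss = map (\<lambda>i. map (\<lambda>j. xss ! j ! i) [0..<length xss]) [0..<k]"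
    using assms by (intro transpose_rectangle) auto
  moreover have "map (\<lambda>j. xss ! j ! i) [0..<length xss] = map (\<lambda>xs. xs ! i) xss" for i
    by (rule nth_equalityI) auto
  ultimately show ?thesis by simp
qed

lemma finite_list_all2:
  assumes "\<And>t. t \<in> set ts \<Longrightarrow> finite {c. R c t}"
  shows "finite {cs. list_all2 R cs ts}"
  using assms
proof (induction ts)
  case (Cons t ts)
  have "{cs. list_all2 R cs (t # ts)} \<subseteq> (\<lambda>(c, cs). c # cs) ` ({c. R c t} \<times> {cs. list_all2 R cs ts})"
    by (auto simp: list_all2_Cons2)
  moreover have "finite ({c. R c t} \<times> {cs. list_all2 R cs ts})"
    using Cons by auto
  ultimately show ?case by (rule finite_subset[OF _ finite_imageI])
qed simp

lemma set_enum: "finite S \<Longrightarrow> set (enum S) = S"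
  unfolding enum_def
  using someI_ex[of "\<lambda>xs. distinct xs \<and> set xs = S"] finite_distinct_list[of S] by blast

section \<open>The direct product of the summaries and its clones\<close>

locale listed_unit =
  fixes sg :: signature and K :: skb and n :: nat and \<tau>s :: "ctuple list"
  assumes skb: "is_skb sg K"
    and n_pos: "0 < n"
    and nonempty: "\<tau>s \<noteq> []"
    and tuple_length: "\<And>\<tau>. \<tau> \<in> set \<tau>s \<Longrightarrow> length \<tau> = n"
    and tuple_consts: "\<And>\<tau>. \<tau> \<in> set \<tau>s \<Longrightarrow> set \<tau> \<subseteq> consts_of (fst K)"
begin

lemma summary_dataset: "\<tau> \<in> set \<tau>s \<Longrightarrow> is_dataset sg (summary K \<tau>)"
  and summary_consts: "\<tau> \<in> set \<tau>s \<Longrightarrow> set \<tau> \<subseteq> consts_of (summary K \<tau>)"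
  using skb tuple_consts[of \<tau>] unfolding is_skb_def summary_selector_def summary_def by blast+

lemma columns: "transpose \<tau>s = map (\<lambda>i. map (\<lambda>\<tau>. \<tau> ! i) \<tau>s) [0..<n]"
  using nonempty tuple_length by (intro transpose_columns) auto

lemma Fr_iff: "Fresh s \<in> Fr \<tau>s \<longleftrightarrow> (\<exists>i<n. s = map (\<lambda>\<tau>. \<tau> ! i) \<tau>s)"
  unfolding Fr_def prod_tuple_def columns by auto

text \<open>The summaries respect arities, so the chosen constant tuples form a rectangle and the
  terms of the product atom are its columns, accessible by index.\<close>

lemma PrE:
  assumes "(p, ts) \<in> Pr K \<tau>s"
  obtains cs where "length cs = length \<tau>s"
    and "\<And>j. j < length \<tau>s \<Longrightarrow> (p, map Const (cs ! j)) \<in> summary K (\<tau>s ! j)"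
    and "\<And>c. c \<in> set cs \<Longrightarrow> length c = arity sg p"
    and "ts = map (\<lambda>i. Fresh (map (\<lambda>c. c ! i) cs)) [0..<arity sg p]"
proof -
  from assms obtain cs where ts: "ts = prod_tuple cs"
    and cs: "list_all2 (\<lambda>c D. (p, map Const c) \<in> D) cs (map (summary K) \<tau>s)"
    unfolding Pr_def prod_struct_def by blast
  have len: "length cs = length \<tau>s" using list_all2_lengthD[OF cs] by simp
  have mem: "(p, map Const (cs ! j)) \<in> summary K (\<tau>s ! j)" if "j < length \<tau>s" for j
    using list_all2_nthD[OF cs, of j] that len by simp
  have ar: "length c = arity sg p" if c: "c \<in> set cs" for c
  proof -
    obtain j where j: "j < length \<tau>s" "c = cs ! j" using c len by (auto simp: in_set_conv_nth)
    have "respects_arity sg (summary K (\<tau>s ! j))"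
      using summary_dataset[of "\<tau>s ! j"] j(1) by (simp add: is_dataset_def)
    with mem[OF j(1)] show ?thesis by (auto simp: respects_arity_def j(2))
  qed
  have "cs \<noteq> []" using len nonempty by auto
  then have "ts = map (\<lambda>i. Fresh (map (\<lambda>c. c ! i) cs)) [0..<arity sg p]"
    unfolding ts prod_tuple_def using ar by (subst transpose_columns) auto
  with len mem ar that show thesis by blast
qed

text \<open>The atom chosen from each factor is given as a function of the tuple, which matches the
  later use with one homomorphism per tuple.\<close>

lemma PrI:
  assumes "\<And>\<tau>. \<tau> \<in> set \<tau>s \<Longrightarrow> (p, map Const (f \<tau>)) \<in> summary K \<tau>"
    and "\<And>\<tau>. \<tau> \<in> set \<tau>s \<Longrightarrow> length (f \<tau>) = k"
  shows "(p, map (\<lambda>i. Fresh (map (\<lambda>\<tau>. f \<tau> ! i) \<tau>s)) [0..<k]) \<in> Pr K \<tau>s"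
proof -
  have "prod_tuple (map f \<tau>s) = map (\<lambda>i. Fresh (map (\<lambda>\<tau>. f \<tau> ! i) \<tau>s)) [0..<k]"
    unfolding prod_tuple_def using assms(2) nonempty
    by (subst transpose_columns[where k = k]) auto
  moreover have "list_all2 (\<lambda>c D. (p, map Const c) \<in> D) (map f \<tau>s) (map (summary K) \<tau>s)"
    using assms(1) by (auto simp: list_all2_conv_all_nth)
  ultimately show ?thesis unfolding Pr_def prod_struct_def by force
qed

lemma self_in_term_clones: "t \<in> term_clones K \<tau>s t"
  by (cases t) auto

text \<open>Clones exclude the atom they come from, but \<open>Pr\<close> adds it back, and each
  term is one of its own clones. The union therefore has one uniform description.\<close>

lemma Pr_Un_Cl:
  "Pr K \<tau>s \<union> Cl K \<tau>s =
     {(p, cs) | p cs ts. (p, ts) \<in> Pr K \<tau>s \<and> list_all2 (\<lambda>c t. c \<in> term_clones K \<tau>s t) cs ts}"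
  (is "_ = ?R")
proof (intro equalityI subsetI)
  have self: "list_all2 (\<lambda>c t. c \<in> term_clones K \<tau>s t) ts ts" for ts
    by (simp add: list_all2_same self_in_term_clones)
  fix a assume "a \<in> Pr K \<tau>s \<union> Cl K \<tau>s"
  then obtain p ts where p: "(p, ts) \<in> Pr K \<tau>s" "a = (p, ts) \<or> a \<in> clones K \<tau>s (p, ts)"
    unfolding Cl_def by (cases a) auto
  then obtain cs where "a = (p, cs)" "list_all2 (\<lambda>c t. c \<in> term_clones K \<tau>s t) cs ts"
    using self unfolding clones_def by auto
  with p(1) show "a \<in> ?R" by blast
next
  fix a assume "a \<in> ?R"
  then obtain p cs ts where a: "a = (p, cs)" "(p, ts) \<in> Pr K \<tau>s"
    "list_all2 (\<lambda>c t. c \<in> term_clones K \<tau>s t) cs ts" by blast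
  then have "a \<in> clones K \<tau>s (p, ts) \<or> a = (p, ts)" unfolding clones_def by simp
  with a(2) show "a \<in> Pr K \<tau>s \<union> Cl K \<tau>s" unfolding Cl_def by blast
qed

text \<open>The predicate of a product atom occurs in the first summary, which leaves finitely many
  predicates. For each of them every factor offers finitely many argument tuples.\<close>

lemma finite_Pr: "finite (Pr K \<tau>s)"
proof -
  let ?B = "\<lambda>p. {cs. list_all2 (\<lambda>c D. (p, map Const c) \<in> D) cs (map (summary K) \<tau>s)}"
  have fin: "finite (summary K \<tau>)" if "\<tau> \<in> set \<tau>s" for \<tau>
    using summary_dataset[OF that] by (simp add: is_dataset_def)
  have "finite {c. (p, map Const c) \<in> summary K \<tau>}" if "\<tau> \<in> set \<tau>s" for p \<tau>
  proof -
    have "inj (\<lambda>c. (p, map Const c))" by (simp add: inj_on_def)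
    from finite_vimageI[OF fin[OF that] this] show ?thesis by (simp add: vimage_def)
  qed
  then have "finite (?B p)" for p by (intro finite_list_all2) auto
  then have "finite (\<Union>p\<in>fst ` summary K (hd \<tau>s). (\<lambda>cs. (p, prod_tuple cs)) ` ?B p)"
    using fin[of "hd \<tau>s"] nonempty by auto
  moreover have "Pr K \<tau>s \<subseteq> (\<Union>p\<in>fst ` summary K (hd \<tau>s). (\<lambda>cs. (p, prod_tuple cs)) ` ?B p)"
  proof
    fix a assume "a \<in> Pr K \<tau>s"
    then obtain p cs where a: "a = (p, prod_tuple cs)" "cs \<in> ?B p"
      unfolding Pr_def prod_struct_def by blast
    then have "p \<in> fst ` summary K (hd \<tau>s)"
      using nonempty by (cases \<tau>s) (force simp: list_all2_Cons2)+
    with a show "a \<in> (\<Union>p\<in>fst ` summary K (hd \<tau>s). (\<lambda>cs. (p, prod_tuple cs)) ` ?B p)" by blast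
  qed
  ultimately show ?thesis by (rule finite_subset[rotated])
qed

lemma finite_Pr_Un_Cl: "finite (Pr K \<tau>s \<union> Cl K \<tau>s)"
proof -
  let ?B = "\<lambda>ts. {cs. list_all2 (\<lambda>c t. c \<in> term_clones K \<tau>s t) cs ts}"
  have "finite {c. c \<in> term_clones K \<tau>s t}" for t by (cases t) auto
  then have "finite (?B ts)" for ts by (intro finite_list_all2)
  then have "finite (\<Union>(p, ts)\<in>Pr K \<tau>s. Pair p ` ?B ts)" using finite_Pr by auto
  moreover have "Pr K \<tau>s \<union> Cl K \<tau>s \<subseteq> (\<Union>(p, ts)\<in>Pr K \<tau>s. Pair p ` ?B ts)"
    unfolding Pr_Un_Cl by blast
  ultimately show ?thesis by (rule finite_subset[rotated])
qed

lemma atm_Phi: "atm (Phi K \<tau>s) = (\<lambda>(p, ts). (p, map (mu K \<tau>s) ts)) ` (Pr K \<tau>s \<union> Cl K \<tau>s)"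
  unfolding atm_def Phi_def using set_enum[OF finite_imageI[OF finite_Pr_Un_Cl]] by simp

lemma free_vars_Phi: "free_vars (Phi K \<tau>s) = map (\<lambda>i. xvar (map (\<lambda>\<tau>. \<tau> ! i) \<tau>s)) [0..<n]"
  by (simp add: Phi_def columns)

lemma atm_PhiI:
  assumes "(p, ts) \<in> Pr K \<tau>s" "list_all2 (\<lambda>c t. c \<in> term_clones K \<tau>s t) cs ts"
  shows "(p, map (mu K \<tau>s) cs) \<in> atm (Phi K \<tau>s)"
  unfolding atm_Phi Pr_Un_Cl using assms by force

lemma atm_PhiE:
  assumes "(p, us) \<in> atm (Phi K \<tau>s)"
  obtains ts cs where "(p, ts) \<in> Pr K \<tau>s" "list_all2 (\<lambda>c t. c \<in> term_clones K \<tau>s t) cs ts"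
    "us = map (mu K \<tau>s) cs"
  using assms unfolding atm_Phi Pr_Un_Cl by auto

lemma finite_atm_Phi: "finite (atm (Phi K \<tau>s))"
  by (simp add: atm_def)

lemma respects_arity_Phi: "respects_arity sg (atm (Phi K \<tau>s))"
  unfolding respects_arity_def
proof clarify
  fix p us assume "(p, us) \<in> atm (Phi K \<tau>s)"
  then obtain ts cs where ts: "(p, ts) \<in> Pr K \<tau>s" and
    cs: "list_all2 (\<lambda>c t. c \<in> term_clones K \<tau>s t) cs ts" "us = map (mu K \<tau>s) cs"
    by (rule atm_PhiE)
  from ts have "length ts = arity sg p" by (rule PrE) simp
  with cs show "length us = arity sg p" by (auto dest: list_all2_lengthD)
qed

text \<open>Only a generic sequence is ever replaced by a constant, by \<open>mu\<close> or by a
  clone. All its entries agree, so its head is also its \<open>j\<close>-th entry.\<close>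

lemma term_clones_coordinate:
  assumes "Fresh s \<in> dom_of (Pr K \<tau>s)" "c \<in> term_clones K \<tau>s (Fresh s)" "j < length s"
    and x: "\<And>s. h (Var (xvar s)) = Const (s ! j)" and y: "\<And>s. h (Var (yvar s)) = Const (s ! j)"
    and c: "\<And>c. h (Const c) = Const c"
  shows "h (mu K \<tau>s c) = Const (s ! j)"
proof -
  have "hd s = s ! j" if "Fresh s \<in> Ge K \<tau>s"
  proof -
    have "s ! j \<in> set s" "hd s \<in> set s" using assms(3) by (auto intro: hd_in_set)
    with that show ?thesis unfolding Ge_def by blast
  qed
  with assms(2) x y c show ?thesis by (auto split: if_splits)
qed

text \<open>
  Reading the variables \<open>x\<^sub>s\<close> and \<open>y\<^sub>s\<close> as the \<open>j\<close>-th entry of \<open>s\<close> projects the direct product,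
  clones included, onto its \<open>j\<close>-th factor.
\<close>

lemma Phi_projection:
  assumes "\<tau> \<in> set \<tau>s"
  obtains h where "is_hom (range Const) (atm (Phi K \<tau>s)) (summary K \<tau>) h"
    "map (\<lambda>x. h (Var x)) (free_vars (Phi K \<tau>s)) = map Const \<tau>"
proof -
  obtain j where j: "j < length \<tau>s" "\<tau>s ! j = \<tau>" using assms by (auto simp: in_set_conv_nth)
  \<comment> \<open>\<open>case_sum id id\<close> discards the tag that separates the two kinds of
    variables; both then decode to the sequence \<open>s\<close>.\<close>
  define h where "h t = (case t of Const c \<Rightarrow> Const c
    | Var v \<Rightarrow> Const (list_decode (case_sum id id (sum_decode v)) ! j))" for t
  have h: "h (Var (xvar s)) = Const (s ! j)" "h (Var (yvar s)) = Const (s ! j)"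
    "h (Const c) = Const c" for s c
    by (simp_all add: h_def xvar_def yvar_def)
  have "is_hom (range Const) (atm (Phi K \<tau>s)) (summary K \<tau>) h"
  proof (rule is_homI)
    fix p us assume "(p, us) \<in> atm (Phi K \<tau>s)"
    then obtain ts cs where ts: "(p, ts) \<in> Pr K \<tau>s" and
      cs: "list_all2 (\<lambda>c t. c \<in> term_clones K \<tau>s t) cs ts" "us = map (mu K \<tau>s) cs"
      by (rule atm_PhiE)
    obtain cc where cc: "length cc = length \<tau>s"
      "\<And>j. j < length \<tau>s \<Longrightarrow> (p, map Const (cc ! j)) \<in> summary K (\<tau>s ! j)"
      "\<And>c. c \<in> set cc \<Longrightarrow> length c = arity sg p"
      "ts = map (\<lambda>i. Fresh (map (\<lambda>c. c ! i) cc)) [0..<arity sg p]"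
      using PrE[OF ts] by metis
    have "map h us = map Const (cc ! j)"
    proof (rule nth_equalityI)
      show len: "length (map h us) = length (map Const (cc ! j))"
        using cs cc j by (auto dest: list_all2_lengthD)
      fix i assume i: "i < length (map h us)"
      then have i': "i < arity sg p" using len cc(1,3) j by simp
      let ?s = "map (\<lambda>c. c ! i) cc"
      have ti: "ts ! i = Fresh ?s" using i' cc(4) by simp
      have "Fresh ?s \<in> dom_of (Pr K \<tau>s)"
        using ts by (rule dom_ofI) (use i' cc(4) in auto)
      moreover have "cs ! i \<in> term_clones K \<tau>s (Fresh ?s)"
        using list_all2_nthD[OF cs(1), of i] ti i cs(2) by simp
      ultimately have "h (mu K \<tau>s (cs ! i)) = Const (?s ! j)"
        by (rule term_clones_coordinate[OF _ _ _ h]) (use j(1) cc(1) in simp)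
      then show "map h us ! i = map Const (cc ! j) ! i"
        using i i' j(1) cc(1,3) cs(2) by simp
    qed
    then show "(p, map h us) \<in> summary K \<tau>" using cc(2)[OF j(1)] j(2) by simp
  qed (auto simp: h)
  moreover have "map (\<lambda>x. h (Var x)) (free_vars (Phi K \<tau>s)) = map Const \<tau>"
    unfolding free_vars_Phi using j tuple_length[OF assms]
    by (intro nth_equalityI) (simp_all add: h)
  ultimately show thesis by (rule that)
qed

text \<open>
  The homomorphisms into the summaries combine into one into the direct product. It sends a constant
  \<open>c\<close> to the fresh constant indexed by a constant sequence; the clones provide the atoms that are
  needed when this fresh constant becomes a free variable.
\<close>

lemma arrow_Phi:
  assumes inst: "set \<tau>s \<subseteq> inst \<phi> K"
  obtains g where "is_hom (range Const) (atm \<phi>) (atm (Phi K \<tau>s)) g"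
    "map (\<lambda>x. g (Var x)) (free_vars \<phi>) = map Var (free_vars (Phi K \<tau>s))"
proof -
  have "\<forall>\<tau>\<in>set \<tau>s. \<exists>h. is_hom (range Const) (atm \<phi>) (summary K \<tau>) h \<and>
      map (\<lambda>x. h (Var x)) (free_vars \<phi>) = map Const \<tau>"
    using inst unfolding inst_def outp_def by blast
  from bchoice[OF this] obtain H where H0:
    "\<forall>\<tau>\<in>set \<tau>s. is_hom (range Const) (atm \<phi>) (summary K \<tau>) (H \<tau>) \<and>
      map (\<lambda>x. H \<tau> (Var x)) (free_vars \<phi>) = map Const \<tau>" ..
  have H: "is_hom (range Const) (atm \<phi>) (summary K \<tau>) (H \<tau>)"
    "map (\<lambda>x. H \<tau> (Var x)) (free_vars \<phi>) = map Const \<tau>" if "\<tau> \<in> set \<tau>s" for \<tau>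
    using bspec[OF H0 that] by simp_all
  \<comment> \<open>\<open>v\<close> strips \<open>Const\<close> from the values of
    \<open>H\<close>; on the terms of \<phi> these are constants because summaries are
    datasets.\<close>
  define v where "v \<tau> t = (THE c. H \<tau> t = Const c)" for \<tau> t
  have v: "v \<tau> t = c" if "H \<tau> t = Const c" for \<tau> t c
    unfolding v_def using that by simp
  have Hv: "H \<tau> t = Const (v \<tau> t)" if "\<tau> \<in> set \<tau>s" "t \<in> dom_of (atm \<phi>)" for \<tau> t
  proof -
    have "H \<tau> t \<in> dom_of (summary K \<tau>)" using H(1)[OF that(1)] that(2) by (auto simp: is_hom_def)
    then have "H \<tau> t \<in> range Const" using summary_dataset[OF that(1)] by (auto simp: is_dataset_def)
    then show ?thesis using v by auto
  qed
  define s where "s t = map (\<lambda>\<tau>. v \<tau> t) \<tau>s" for t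
  \<comment> \<open>Constants must stay fixed even when \<open>mu\<close> would turn the
    corresponding product term into a free variable; only variables follow the product.\<close>
  define g where "g t = (case t of Const c \<Rightarrow> Const c | Var x \<Rightarrow> mu K \<tau>s (Fresh (s t)))" for t
  have len: "length (free_vars \<phi>) = n"
    using arg_cong[OF H(2)[of "hd \<tau>s"], of length] nonempty tuple_length[of "hd \<tau>s"] by simp
  have "is_hom (range Const) (atm \<phi>) (atm (Phi K \<tau>s)) g"
  proof (rule is_homI)
    fix p ts assume a: "(p, ts) \<in> atm \<phi>"
    have t_dom: "t \<in> dom_of (atm \<phi>)" if "t \<in> set ts" for t using a that by (rule dom_ofI)
    have "(p, map Const (map (v \<tau>) ts)) \<in> summary K \<tau>" if \<tau>: "\<tau> \<in> set \<tau>s" for \<tau>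
    proof -
      have "(p, map (H \<tau>) ts) \<in> summary K \<tau>" using H(1)[OF \<tau>] a by (auto simp: is_hom_def)
      moreover have "map (H \<tau>) ts = map Const (map (v \<tau>) ts)" using Hv[OF \<tau> t_dom] by simp
      ultimately show ?thesis by simp
    qed
    then have "(p, map (\<lambda>i. Fresh (map (\<lambda>\<tau>. map (v \<tau>) ts ! i) \<tau>s)) [0..<length ts]) \<in> Pr K \<tau>s"
      by (rule PrI) simp_all
    moreover have "map (\<lambda>i. Fresh (map (\<lambda>\<tau>. map (v \<tau>) ts ! i) \<tau>s)) [0..<length ts]
        = map (\<lambda>t. Fresh (s t)) ts"
      by (rule nth_equalityI) (simp_all add: s_def)
    ultimately have P: "(p, map (\<lambda>t. Fresh (s t)) ts) \<in> Pr K \<tau>s" by simp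
    have const: "s (Const c) = map (\<lambda>_. c) \<tau>s" if "Const c \<in> set ts" for c
    proof -
      have "H \<tau> (Const c) = Const c" if "\<tau> \<in> set \<tau>s" for \<tau>
        using H(1)[OF that] t_dom[OF \<open>Const c \<in> set ts\<close>] by (auto simp: is_hom_def)
      then show ?thesis by (simp add: s_def v)
    qed
    have Ge: "Fresh (s (Const c)) \<in> Ge K \<tau>s" "hd (s (Const c)) = c" if "Const c \<in> set ts" for c
    proof -
      have "Fresh (s (Const c)) \<in> dom_of (Pr K \<tau>s)" using P by (rule dom_ofI) (use that in auto)
      then show "Fresh (s (Const c)) \<in> Ge K \<tau>s" using const[OF that] by (auto simp: Ge_def)
      show "hd (s (Const c)) = c" using const[OF that] nonempty by (simp add: hd_map)
    qed
    \<comment> \<open>For a constant whose product term is free, \<open>e\<close> selects the clone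
      that keeps the constant. Otherwise the product term itself suffices, and \<open>mu\<close>
      sends it to the value of \<open>g\<close>.\<close>
    define e where "e t = (case t of
        Const c \<Rightarrow> if Fresh (s t) \<in> Fr \<tau>s then Orig c else Fresh (s t)
      | Var x \<Rightarrow> Fresh (s t))" for t
    have "e t \<in> term_clones K \<tau>s (Fresh (s t)) \<and> mu K \<tau>s (e t) = g t" if "t \<in> set ts" for t
    proof (cases t)
      case (Const c)
      then show ?thesis using Ge[of c] that by (simp add: e_def g_def)
    next
      case (Var x)
      then show ?thesis by (simp add: e_def g_def)
    qed
    then have "list_all2 (\<lambda>c t. c \<in> term_clones K \<tau>s t) (map e ts) (map (\<lambda>t. Fresh (s t)) ts)"
      and "map (mu K \<tau>s) (map e ts) = map g ts"
      by (auto simp: list_all2_conv_all_nth)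
    with atm_PhiI[OF P] show "(p, map g ts) \<in> atm (Phi K \<tau>s)" by metis
  qed (auto simp: g_def)
  moreover have "map (\<lambda>x. g (Var x)) (free_vars \<phi>) = map Var (free_vars (Phi K \<tau>s))"
  proof (rule nth_equalityI)
    fix i assume "i < length (map (\<lambda>x. g (Var x)) (free_vars \<phi>))"
    then have i: "i < n" using len by simp
    let ?x = "free_vars \<phi> ! i"
    have "H \<tau> (Var ?x) = Const (\<tau> ! i)" if "\<tau> \<in> set \<tau>s" for \<tau>
      using arg_cong[OF H(2)[OF that], of "\<lambda>xs. xs ! i"] i len tuple_length[OF that] by simp
    then have "s (Var ?x) = map (\<lambda>\<tau>. \<tau> ! i) \<tau>s" by (simp add: s_def v)
    then show "map (\<lambda>x. g (Var x)) (free_vars \<phi>) ! i = map Var (free_vars (Phi K \<tau>s)) ! i"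
      using i len Fr_iff by (auto simp: g_def free_vars_Phi)
  qed (simp add: len free_vars_Phi)
  ultimately show thesis by (rule that)
qed

text \<open>Each summary contains the constants of its tuple and is closed under the top predicate.
  The product of these unary atoms ensures that each free variable occurs in the body.\<close>

lemma top_atom_Phi:
  assumes "x \<in> set (free_vars (Phi K \<tau>s))"
  shows "(top_pred sg, [Var x]) \<in> atm (Phi K \<tau>s)"
proof -
  from assms obtain i where i: "i < n" "x = xvar (map (\<lambda>\<tau>. \<tau> ! i) \<tau>s)"
    by (auto simp: free_vars_Phi)
  have "(top_pred sg, map Const [\<tau> ! i]) \<in> summary K \<tau>" if \<tau>: "\<tau> \<in> set \<tau>s" for \<tau>
  proof -
    have "\<tau> ! i \<in> set \<tau>" using i(1) tuple_length[OF \<tau>] by simp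
    then have "Const (\<tau> ! i) \<in> dom_of (summary K \<tau>)"
      using summary_consts[OF \<tau>] by (auto simp: consts_of_def)
    then show ?thesis using summary_dataset[OF \<tau>] by (simp add: is_dataset_def top_closed_def)
  qed
  then have "(top_pred sg, map (\<lambda>k. Fresh (map (\<lambda>\<tau>. [\<tau> ! i] ! k) \<tau>s)) [0..<1]) \<in> Pr K \<tau>s"
    by (rule PrI) simp_all
  then have "(top_pred sg, [Fresh (map (\<lambda>\<tau>. \<tau> ! i) \<tau>s)]) \<in> Pr K \<tau>s" by simp
  then have "(top_pred sg, map (mu K \<tau>s) [Fresh (map (\<lambda>\<tau>. \<tau> ! i) \<tau>s)]) \<in> atm (Phi K \<tau>s)"
    by (rule atm_PhiI) (simp add: self_in_term_clones)
  moreover have "Fresh (map (\<lambda>\<tau>. \<tau> ! i) \<tau>s) \<in> Fr \<tau>s" using i(1) Fr_iff by blast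
  ultimately show ?thesis by (simp add: i(2))
qed

end


section \<open>The nearly connected part: \<open>can U K\<close> as the most specific explanation of
  \<open>U\<close>\<close>

locale listed_K_unit = listed_unit sg K n "enum U" for sg K n U +
  assumes finite_U: "finite U"
begin

abbreviation "\<Phi> \<equiv> Phi K (enum U)"

lemma free_vars_can: "free_vars (can U K) = free_vars \<Phi>"
  by (simp add: can_def Let_def)

lemma free_vars_nonempty: "free_vars \<Phi> \<noteq> []"
  using n_pos by (simp add: free_vars_Phi)

lemma atm_can: "atm (can U K) = max_nc_part (free_vars \<Phi>) (atm \<Phi>)"
  using max_nc_part_subset[OF finite_atm_Phi free_vars_nonempty]
  by (auto simp: can_def Let_def atm_def)

text \<open>The top atom of a free variable is nearly connected on its own, so it survives the
  restriction to the greatest nearly connected part.\<close>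

lemma top_atom_can:
  assumes "x \<in> set (free_vars \<Phi>)"
  shows "(top_pred sg, [Var x]) \<in> atm (can U K)"
proof -
  have "{(top_pred sg, [Var x])} \<subseteq> max_nc_part (free_vars \<Phi>) (atm \<Phi>)"
    using top_atom_Phi[OF assms] nearly_connected_single[OF assms, of "[Var x]" "top_pred sg"]
    by (intro max_nc_part_greatest[OF finite_atm_Phi free_vars_nonempty]) simp_all
  then show ?thesis by (simp add: atm_can)
qed

lemma atm_can_subset: "atm (can U K) \<subseteq> atm \<Phi>"
  unfolding atm_can by (rule max_nc_part_subset[OF finite_atm_Phi free_vars_nonempty])

lemma can_NXL: "can U K \<in> NXL sg"
proof -
  have "body (can U K) \<noteq> []"
    using top_atom_can[of "hd (free_vars \<Phi>)"] free_vars_nonempty by (auto simp: atm_def)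
  moreover have "respects_arity sg (atm (can U K))"
    using atm_can_subset respects_arity_Phi unfolding respects_arity_def by blast
  moreover have "Var x \<in> dom_of (atm (can U K))" if "x \<in> set (free_vars (can U K))" for x
    using top_atom_can[of x] that by (auto simp: free_vars_can intro: dom_ofI)
  moreover have "nearly_connected (free_vars (can U K)) (atm (can U K))"
    unfolding atm_can free_vars_can
    by (rule nearly_connected_max_nc_part[OF finite_atm_Phi free_vars_nonempty])
  ultimately show ?thesis
    using free_vars_nonempty by (simp add: NXL_def formulas_def free_vars_can)
qed

lemma can_formula: "can U K \<in> formulas sg"
  using can_NXL by (simp add: NXL_def)

lemma can_interprets: "U \<subseteq> inst (can U K) K"
proof
  fix \<tau> assume "\<tau> \<in> U"
  then have \<tau>: "\<tau> \<in> set (enum U)" by (simp add: set_enum finite_U)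
  then obtain h where h: "is_hom (range Const) (atm \<Phi>) (summary K \<tau>) h"
    "map (\<lambda>x. h (Var x)) (free_vars \<Phi>) = map Const \<tau>" by (rule Phi_projection)
  then have "is_hom (range Const) (atm (can U K)) (summary K \<tau>) h"
    using atm_can_subset is_hom_mono by metis
  with h(2) tuple_consts[OF \<tau>] show "\<tau> \<in> inst (can U K) K"
    unfolding inst_def outp_def free_vars_can by blast
qed

text \<open>The homomorphism into \<Phi> has a nearly connected image, because explanations are
  nearly connected. The image thus lies in the greatest nearly connected part, which is the body of
  \<open>can U K\<close>.\<close>

lemma interprets_arrow_can:
  assumes "\<phi> \<in> NXL sg" "U \<subseteq> inst \<phi> K"
  shows "arrow \<phi> (can U K)"
proof -
  have "set (enum U) \<subseteq> inst \<phi> K" using assms(2) by (simp add: set_enum finite_U)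
  then obtain g where g: "is_hom (range Const) (atm \<phi>) (atm \<Phi>) g"
    "map (\<lambda>x. g (Var x)) (free_vars \<phi>) = map Var (free_vars \<Phi>)"
    by (rule arrow_Phi)
  let ?I = "(\<lambda>(p, ts). (p, map g ts)) ` atm \<phi>"
  have "?I \<subseteq> max_nc_part (free_vars \<Phi>) (atm \<Phi>)"
  proof (rule max_nc_part_greatest[OF finite_atm_Phi free_vars_nonempty])
    show "?I \<subseteq> atm \<Phi>" using g(1) by (auto simp: is_hom_def)
    show "nearly_connected (free_vars \<Phi>) ?I"
      using assms(1) g(2) by (intro nearly_connected_image) (simp_all add: NXL_def)
  qed
  then have "is_hom (range Const) (atm \<phi>) (atm (can U K)) g"
    using g(1) unfolding atm_can by (intro is_homI) (auto simp: is_hom_def)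
  with g(2) show ?thesis unfolding arrow_def formula_hom_def free_vars_can by blast
qed

lemma core_char_equivalent: "equivalent (core_char sg U K) (can U K)"
  and core_char_minimal: "minimal_formula sg (core_char sg U K)"
  unfolding core_char_def by (rule core_of[OF can_formula])+

lemma inst_core_char: "inst (core_char sg U K) K = inst (can U K) K"
  by (rule equivalent_inst[OF core_char_equivalent])

end

lemma K_unit_listed:
  assumes "is_skb sg K" "is_K_unit K n U"
  shows "listed_K_unit sg K n U"
proof -
  have "finite U" using assms(2) by (simp add: is_K_unit_def is_unit_def)
  moreover from this have "set (enum U) = U" by (rule set_enum)
  moreover have "enum U \<noteq> []"
    using \<open>set (enum U) = U\<close> assms(2) by (auto simp: is_K_unit_def is_unit_def)
  ultimately show ?thesis
    using assms by unfold_locales (simp_all add: is_K_unit_def is_unit_def)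
qed

text \<open>Properness passes to larger sets: a tuple that separates two positions is still
  present.\<close>

lemma is_unit_mono:
  assumes "is_unit n U" "U \<subseteq> U'" "finite U'" "\<And>\<tau>. \<tau> \<in> U' \<Longrightarrow> length \<tau> = n"
  shows "is_unit n U'"
  using assms unfolding is_unit_def by blast


section \<open>The expansion graph\<close>

text \<open>The arcs are the Hasse diagram of this strict order.\<close>

definition node_order :: "signature \<Rightarrow> formula set set \<Rightarrow> (formula set \<times> formula set) set" where
  "node_order sg N =
     {(iso_class sg \<phi>1, iso_class sg \<phi>2) | \<phi>1 \<phi>2.
        \<phi>1 \<in> formulas sg \<and> \<phi>2 \<in> formulas sg \<and>
        iso_class sg \<phi>1 \<in> N \<and> iso_class sg \<phi>2 \<in> N \<and>
        iso_class sg \<phi>1 \<noteq> iso_class sg \<phi>2 \<and> arrow \<phi>2 \<phi>1}"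

text \<open>Among the predecessors of \<open>y\<close> that equal or follow \<open>x\<close>, choose
  a \<open>Q\<close>-maximal \<open>z\<close>. An element strictly between \<open>z\<close> and
  \<open>y\<close> would contradict this choice.\<close>

lemma finite_acyclic_cover:
  assumes "finite Q" "acyclic Q" "trans Q" "(x, y) \<in> Q"
  obtains z where "(z, y) \<in> Q - Q O Q" "x = z \<or> (x, z) \<in> Q"
proof -
  have "wf (Q\<inverse>)" using assms by (intro finite_acyclic_wf_converse)
  moreover have "x \<in> {z. (z, y) \<in> Q \<and> (x = z \<or> (x, z) \<in> Q)}" using assms(4) by simp
  ultimately obtain z where z: "(z, y) \<in> Q" "x = z \<or> (x, z) \<in> Q"
    "\<And>w. (w, z) \<in> Q\<inverse> \<Longrightarrow> w \<notin> {z. (z, y) \<in> Q \<and> (x = z \<or> (x, z) \<in> Q)}"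
    by (rule wfE_min) blast
  have "(z, y) \<notin> Q O Q"
  proof
    assume "(z, y) \<in> Q O Q"
    then obtain w where w: "(z, w) \<in> Q" "(w, y) \<in> Q" by blast
    then have "(x, w) \<in> Q" using z(2) assms(3) by (auto dest: transD)
    with z(3)[of w] w show False by blast
  qed
  with z that show thesis by blast
qed

locale expansion =
  fixes sg :: signature and K :: skb and n :: nat and U :: "ctuple set"
  assumes skb: "is_skb sg K" and unit: "is_K_unit K n U"
begin

abbreviation "T \<equiv> tuples n (fst K)"
abbreviation "c \<tau> \<equiv> core_char sg (insert \<tau> U) K"
abbreviation "k \<tau> \<equiv> iso_class sg (c \<tau>)"
abbreviation "N \<equiv> eg_nodes sg n U K"
abbreviation "A \<equiv> eg_arcs sg N"
abbreviation "Q \<equiv> node_order sg N"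

section \<open>Tuples, their cores and their nodes\<close>

lemma finite_T: "finite T"
proof -
  have "finite (fst K)" using skb by (simp add: is_skb_def is_dataset_def)
  then have "finite (Const -` dom_of (fst K))"
    by (intro finite_vimageI finite_dom_of) (auto simp: inj_on_def)
  then have "finite (consts_of (fst K))" by (simp add: consts_of_def vimage_def)
  from finite_lists_length_eq[OF this, of n] show ?thesis
    by (simp add: tuples_def conj_commute)
qed

lemma U_subset: "U \<subseteq> T"
  using unit by (auto simp: is_K_unit_def is_unit_def tuples_def)

text \<open>Adding a tuple of \<open>U\<close> to \<open>U\<close> changes nothing, which makes the
  class of the core of \<open>U\<close> itself a node.\<close>

lemma U_tuple: obtains \<tau> where "\<tau> \<in> U" "\<tau> \<in> T" "c \<tau> = core_char sg U K"
proof -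
  obtain \<tau> where "\<tau> \<in> U" using unit by (auto simp: is_K_unit_def is_unit_def)
  then show thesis using that[of \<tau>] U_subset by (auto simp: insert_absorb)
qed

lemma insert_unit: "\<tau> \<in> T \<Longrightarrow> is_K_unit K n (insert \<tau> U)"
  using unit is_unit_mono[of n U "insert \<tau> U"]
  unfolding is_K_unit_def by (auto simp: is_unit_def tuples_def)

lemma listed: "\<tau> \<in> T \<Longrightarrow> listed_K_unit sg K n (insert \<tau> U)"
  by (rule K_unit_listed[OF skb insert_unit])

lemma listed_U: "listed_K_unit sg K n U"
  by (rule K_unit_listed[OF skb unit])

lemma minimal_c: "\<tau> \<in> T \<Longrightarrow> minimal_formula sg (c \<tau>)"
  by (rule listed_K_unit.core_char_minimal[OF listed])

lemma formula_c: "\<tau> \<in> T \<Longrightarrow> c \<tau> \<in> formulas sg"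
  using minimal_c by (simp add: minimal_formula_def)

lemma inst_subset_T:
  assumes "\<tau> \<in> T"
  shows "inst (c \<tau>) K \<subseteq> T"
proof
  interpret l: listed_K_unit sg K n "insert \<tau> U" by (rule listed[OF assms])
  fix \<sigma> assume "\<sigma> \<in> inst (c \<tau>) K"
  then have \<sigma>: "\<sigma> \<in> inst (can (insert \<tau> U) K) K" by (simp add: l.inst_core_char)
  then have "length \<sigma> = n"
    using inst_length[OF \<sigma>] by (simp add: l.free_vars_can l.free_vars_Phi)
  with \<sigma> show "\<sigma> \<in> T" by (simp add: tuples_def inst_def)
qed

lemma U_subset_inst: "\<tau> \<in> T \<Longrightarrow> insert \<tau> U \<subseteq> inst (c \<tau>) K"
  using listed_K_unit.can_interprets[OF listed] listed_K_unit.inst_core_char[OF listed] by metis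

text \<open>If \<sigma> is an instance, the canonical formula for \<tau> interprets
  \<open>insert \<sigma> U\<close> and so maps to the canonical formula of that unit; equivalence
  transfers this to cores. The converse is antimonotonicity of instances.\<close>

lemma inst_iff_arrow:
  assumes "\<sigma> \<in> T" "\<tau> \<in> T"
  shows "\<sigma> \<in> inst (c \<tau>) K \<longleftrightarrow> arrow (c \<tau>) (c \<sigma>)"
proof
  interpret l: listed_K_unit sg K n "insert \<tau> U" by (rule listed[OF assms(2)])
  interpret m: listed_K_unit sg K n "insert \<sigma> U" by (rule listed[OF assms(1)])
  assume "\<sigma> \<in> inst (c \<tau>) K"
  then have "insert \<sigma> U \<subseteq> inst (can (insert \<tau> U) K) K"
    using l.can_interprets by (simp add: l.inst_core_char)
  then have "arrow (can (insert \<tau> U) K) (can (insert \<sigma> U) K)"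
    by (rule m.interprets_arrow_can[OF l.can_NXL])
  then show "arrow (c \<tau>) (c \<sigma>)"
    using l.core_char_equivalent m.core_char_equivalent arrow_trans
    unfolding equivalent_def by metis
next
  assume "arrow (c \<tau>) (c \<sigma>)"
  then show "\<sigma> \<in> inst (c \<tau>) K"
    using arrow_inst_antimono U_subset_inst[OF assms(1)] by blast
qed

lemma k_eq_iff: "\<sigma> \<in> T \<Longrightarrow> \<tau> \<in> T \<Longrightarrow> k \<sigma> = k \<tau> \<longleftrightarrow> equivalent (c \<sigma>) (c \<tau>)"
  by (intro minimal_iso_class_eq_iff minimal_c)

lemma N_eq: "N = k ` T"
  unfolding eg_nodes_def by auto

lemma finite_N: "finite N"
  unfolding N_eq using finite_T by simp

lemma node_rep:
  assumes "\<phi> \<in> formulas sg" "iso_class sg \<phi> \<in> N"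
  obtains \<tau> where "\<tau> \<in> T" "iso_class sg \<phi> = k \<tau>" "equivalent \<phi> (c \<tau>)"
proof -
  from assms(2) obtain \<tau> where "\<tau> \<in> T" "iso_class sg \<phi> = k \<tau>" unfolding N_eq by blast
  with that iso_class_imp_equivalent[OF assms(1)] show thesis by blast
qed

section \<open>The order on nodes and its covering relation\<close>

lemma Q_iff:
  assumes "\<phi>1 \<in> formulas sg" "iso_class sg \<phi>1 \<in> N" "\<phi>2 \<in> formulas sg" "iso_class sg \<phi>2 \<in> N"
  shows "(iso_class sg \<phi>1, iso_class sg \<phi>2) \<in> Q \<longleftrightarrow>
    iso_class sg \<phi>1 \<noteq> iso_class sg \<phi>2 \<and> arrow \<phi>2 \<phi>1"
proof
  assume "(iso_class sg \<phi>1, iso_class sg \<phi>2) \<in> Q"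
  then obtain \<psi>1 \<psi>2 where \<psi>: "iso_class sg \<phi>1 = iso_class sg \<psi>1" "iso_class sg \<phi>2 = iso_class sg \<psi>2"
    "iso_class sg \<phi>1 \<noteq> iso_class sg \<phi>2" "arrow \<psi>2 \<psi>1" "\<psi>1 \<in> formulas sg"
    unfolding node_order_def by auto
  \<comment> \<open>Equal classes have equivalent representatives, so the arrow does not depend on
    the ones hidden in the definition of \<open>Q\<close>.\<close>
  have "arrow \<phi>2 \<psi>2" "arrow \<psi>1 \<phi>1"
    using iso_class_imp_equivalent[OF assms(3) \<psi>(2)]
      iso_class_imp_equivalent[OF \<psi>(5) \<psi>(1)[symmetric]] by (simp_all add: equivalent_def)
  with \<psi>(3,4) show "iso_class sg \<phi>1 \<noteq> iso_class sg \<phi>2 \<and> arrow \<phi>2 \<phi>1"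
    using arrow_trans by metis
next
  assume "iso_class sg \<phi>1 \<noteq> iso_class sg \<phi>2 \<and> arrow \<phi>2 \<phi>1"
  with assms show "(iso_class sg \<phi>1, iso_class sg \<phi>2) \<in> Q"
    unfolding node_order_def by blast
qed

lemma k_in_N: "\<tau> \<in> T \<Longrightarrow> k \<tau> \<in> N"
  by (simp add: N_eq)

lemma Q_k_iff: "\<sigma> \<in> T \<Longrightarrow> \<tau> \<in> T \<Longrightarrow> (k \<sigma>, k \<tau>) \<in> Q \<longleftrightarrow> k \<sigma> \<noteq> k \<tau> \<and> \<sigma> \<in> inst (c \<tau>) K"
  by (simp add: Q_iff formula_c inst_iff_arrow k_in_N)

lemma Q_subset: "Q \<subseteq> N \<times> N"
  unfolding node_order_def by blast

text \<open>Only distinctness of the outer nodes needs an argument: if they coincided, the middle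
  formula would be equivalent to both.\<close>

lemma trans_Q: "trans Q"
proof (rule transI)
  fix X Y Z assume XY: "(X, Y) \<in> Q" and YZ: "(Y, Z) \<in> Q"
  then have "X \<in> N" "Y \<in> N" "Z \<in> N" using Q_subset by auto
  then obtain \<sigma> \<tau> \<rho> where T: "\<sigma> \<in> T" "\<tau> \<in> T" "\<rho> \<in> T" and k: "X = k \<sigma>" "Y = k \<tau>" "Z = k \<rho>"
    unfolding N_eq by (elim imageE) blast
  have *: "k \<sigma> \<noteq> k \<tau>" "arrow (c \<tau>) (c \<sigma>)" "arrow (c \<rho>) (c \<tau>)"
    using XY YZ T by (simp_all add: k Q_k_iff inst_iff_arrow)
  then have "arrow (c \<rho>) (c \<sigma>)" using arrow_trans by metis
  moreover have "k \<sigma> \<noteq> k \<rho>"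
  proof
    assume "k \<sigma> = k \<rho>"
    then have "arrow (c \<sigma>) (c \<rho>)" using T by (simp add: k_eq_iff equivalent_def)
    then have "arrow (c \<sigma>) (c \<tau>)" using *(3) arrow_trans by metis
    with * T show False by (simp add: k_eq_iff equivalent_def)
  qed
  ultimately show "(X, Z) \<in> Q" using T by (simp add: k Q_k_iff inst_iff_arrow)
qed

lemma acyclic_Q: "acyclic Q"
  unfolding acyclic_def trancl_id[OF trans_Q] by (auto simp: node_order_def)

lemma finite_Q: "finite Q"
  using Q_subset finite_N by (meson finite_SigmaI finite_subset)

text \<open>A formula strictly between the two ends of an arc amounts to a two-step path in
  \<open>Q\<close>. From a path, the middle node supplies such a formula as the core of one of its
  tuples.\<close>

lemma A_eq: "A = Q - Q O Q"
proof -
  have QQ: "(iso_class sg \<phi>1, iso_class sg \<phi>2) \<in> Q O Q \<longleftrightarrow>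
      (\<exists>\<phi>3\<in>formulas sg. iso_class sg \<phi>3 \<in> N - {iso_class sg \<phi>1, iso_class sg \<phi>2} \<and>
              arrow \<phi>2 \<phi>3 \<and> arrow \<phi>3 \<phi>1)"
    (is "?l \<longleftrightarrow> ?r")
    if \<phi>: "\<phi>1 \<in> formulas sg" "iso_class sg \<phi>1 \<in> N" "\<phi>2 \<in> formulas sg" "iso_class sg \<phi>2 \<in> N"
    for \<phi>1 \<phi>2
  proof
    assume ?l
    then obtain Y where Y: "(iso_class sg \<phi>1, Y) \<in> Q" "(Y, iso_class sg \<phi>2) \<in> Q" by blast
    then have "Y \<in> N" using Q_subset by auto
    then obtain \<tau> where \<tau>: "\<tau> \<in> T" "Y = k \<tau>" unfolding N_eq by blast
    then have "k \<tau> \<in> N" using \<open>Y \<in> N\<close> by simp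
    have "iso_class sg \<phi>1 \<noteq> k \<tau> \<and> arrow (c \<tau>) \<phi>1"
      using Q_iff[OF \<phi>(1,2) formula_c[OF \<tau>(1)] \<open>k \<tau> \<in> N\<close>] Y(1) \<tau>(2) by simp
    moreover have "k \<tau> \<noteq> iso_class sg \<phi>2 \<and> arrow \<phi>2 (c \<tau>)"
      using Q_iff[OF formula_c[OF \<tau>(1)] \<open>k \<tau> \<in> N\<close> \<phi>(3,4)] Y(2) \<tau>(2) by simp
    ultimately show ?r using formula_c[OF \<tau>(1)] \<open>k \<tau> \<in> N\<close> by auto
  next
    assume ?r
    then obtain \<phi>3 where 3: "\<phi>3 \<in> formulas sg" "iso_class sg \<phi>3 \<in> N" "iso_class sg \<phi>3 \<noteq> iso_class sg \<phi>1"
      "iso_class sg \<phi>3 \<noteq> iso_class sg \<phi>2" "arrow \<phi>2 \<phi>3" "arrow \<phi>3 \<phi>1" by blast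
    have "(iso_class sg \<phi>1, iso_class sg \<phi>3) \<in> Q" "(iso_class sg \<phi>3, iso_class sg \<phi>2) \<in> Q"
      using 3 \<phi> by (simp_all add: Q_iff)
    then show ?l by blast
  qed
  show ?thesis
  proof (intro equalityI subsetI)
    fix a assume "a \<in> A"
    then obtain \<phi>1 \<phi>2 where a: "a = (iso_class sg \<phi>1, iso_class sg \<phi>2)"
      "\<phi>1 \<in> formulas sg" "iso_class sg \<phi>1 \<in> N" "\<phi>2 \<in> formulas sg" "iso_class sg \<phi>2 \<in> N"
      "iso_class sg \<phi>1 \<noteq> iso_class sg \<phi>2 \<and> arrow \<phi>2 \<phi>1"
      "\<not> (\<exists>\<phi>3\<in>formulas sg. iso_class sg \<phi>3 \<in> N - {iso_class sg \<phi>1, iso_class sg \<phi>2} \<and>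
              arrow \<phi>2 \<phi>3 \<and> arrow \<phi>3 \<phi>1)"
      unfolding eg_arcs_def by blast
    show "a \<in> Q - Q O Q" using Q_iff[OF a(2-5)] QQ[OF a(2-5)] a(1,6,7) by blast
  next
    fix a assume "a \<in> Q - Q O Q"
    then obtain \<phi>1 \<phi>2 where a: "a = (iso_class sg \<phi>1, iso_class sg \<phi>2)"
      "\<phi>1 \<in> formulas sg" "iso_class sg \<phi>1 \<in> N" "\<phi>2 \<in> formulas sg" "iso_class sg \<phi>2 \<in> N"
      "iso_class sg \<phi>1 \<noteq> iso_class sg \<phi>2" "arrow \<phi>2 \<phi>1" "a \<notin> Q O Q"
      unfolding node_order_def by blast
    from a(8) have "\<not> (\<exists>\<phi>3\<in>formulas sg. iso_class sg \<phi>3 \<in> N - {iso_class sg \<phi>1, iso_class sg \<phi>2} \<and>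
              arrow \<phi>2 \<phi>3 \<and> arrow \<phi>3 \<phi>1)"
      unfolding a(1) QQ[OF a(2-5)] .
    with a(1-7) show "a \<in> A" unfolding eg_arcs_def by blast
  qed
qed

lemma dag: "directed_acyclic_graph N A"
  unfolding directed_acyclic_graph_def
  using finite_N Q_subset acyclic_Q by (auto simp: A_eq intro: acyclic_subset)

section \<open>Direct instances as fibres of the node map\<close>

lemma inst_some: "\<tau> \<in> T \<Longrightarrow> inst (SOME \<phi>. \<phi> \<in> k \<tau>) K = inst (c \<tau>) K"
proof -
  assume \<tau>: "\<tau> \<in> T"
  have "c \<tau> \<in> k \<tau>" using formula_c[OF \<tau>] isomorphic_refl by (simp add: iso_class_def)
  then have "(SOME \<phi>. \<phi> \<in> k \<tau>) \<in> k \<tau>" by (rule someI)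
  then have "equivalent (SOME \<phi>. \<phi> \<in> k \<tau>) (c \<tau>)"
    by (simp add: iso_class_def isomorphic_def)
  then show ?thesis by (rule equivalent_inst)
qed

lemma predecessor_instances:
  assumes "\<tau> \<in> T"
  shows "{\<sigma>. \<exists>\<phi>'\<in>formulas sg. \<sigma> \<in> inst \<phi>' K \<and> (iso_class sg \<phi>', k \<tau>) \<in> A}
    = {\<sigma>. \<exists>\<rho>\<in>T. \<sigma> \<in> inst (c \<rho>) K \<and> (k \<rho>, k \<tau>) \<in> A}" (is "?L = ?R")
proof (intro equalityI subsetI)
  fix \<sigma> assume "\<sigma> \<in> ?L"
  then obtain \<phi> where \<phi>: "\<phi> \<in> formulas sg" "\<sigma> \<in> inst \<phi> K" "(iso_class sg \<phi>, k \<tau>) \<in> A" by blast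
  then have "iso_class sg \<phi> \<in> N" using Q_subset A_eq by blast
  with \<phi>(1) obtain \<rho> where "\<rho> \<in> T" "iso_class sg \<phi> = k \<rho>" "equivalent \<phi> (c \<rho>)" by (rule node_rep)
  with \<phi> equivalent_inst show "\<sigma> \<in> ?R" by auto
next
  fix \<sigma> assume "\<sigma> \<in> ?R"
  then show "\<sigma> \<in> ?L" using formula_c by blast
qed

text \<open>An instance \<sigma> with another node lies strictly before \<open>k \<tau>\<close>,
  hence is also an instance of some covering predecessor and is removed. A tuple with node
  \<open>k \<tau>\<close> is never removed: a predecessor having it as an instance would be
  equivalent to \<open>c \<tau>\<close>.\<close>

lemma direct_instances_eq:
  assumes \<tau>: "\<tau> \<in> T"
  shows "direct_instances sg K A (k \<tau>) = {\<sigma>\<in>T. k \<sigma> = k \<tau>}"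
proof -
  have "direct_instances sg K A (k \<tau>)
      = inst (c \<tau>) K - {\<sigma>. \<exists>\<rho>\<in>T. \<sigma> \<in> inst (c \<rho>) K \<and> (k \<rho>, k \<tau>) \<in> A}"
    unfolding direct_instances_def inst_some[OF \<tau>] predecessor_instances[OF \<tau>] ..
  also have "\<dots> = {\<sigma>\<in>T. k \<sigma> = k \<tau>}"
  proof (intro equalityI subsetI)
    fix \<sigma> assume \<sigma>: "\<sigma> \<in> inst (c \<tau>) K - {\<sigma>. \<exists>\<rho>\<in>T. \<sigma> \<in> inst (c \<rho>) K \<and> (k \<rho>, k \<tau>) \<in> A}"
    then have T: "\<sigma> \<in> T" using inst_subset_T[OF \<tau>] by blast
    have "k \<sigma> = k \<tau>"
    proof (rule ccontr)
      assume "k \<sigma> \<noteq> k \<tau>"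
      then have "(k \<sigma>, k \<tau>) \<in> Q" using \<sigma> T \<tau> by (simp add: Q_k_iff)
      \<comment> \<open>Finiteness of the order yields a predecessor of \<open>k \<tau>\<close>
        joined to it by an arc, at or after \<open>k \<sigma>\<close>.\<close>
      then obtain Z where Z: "(Z, k \<tau>) \<in> A" "k \<sigma> = Z \<or> (k \<sigma>, Z) \<in> Q"
        using finite_acyclic_cover[OF finite_Q acyclic_Q trans_Q] unfolding A_eq by metis
      then have "Z \<in> N" using Q_subset A_eq by blast
      then obtain \<rho> where \<rho>: "\<rho> \<in> T" "Z = k \<rho>" unfolding N_eq by blast
      have "arrow (c \<rho>) (c \<sigma>)"
        using Z(2) T \<rho> by (auto simp: k_eq_iff Q_k_iff inst_iff_arrow equivalent_def)
      then have "\<sigma> \<in> inst (c \<rho>) K" using T \<rho>(1) by (simp add: inst_iff_arrow)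
      with \<sigma> \<rho> Z(1) show False by blast
    qed
    with T show "\<sigma> \<in> {\<sigma>\<in>T. k \<sigma> = k \<tau>}" by simp
  next
    fix \<sigma> assume "\<sigma> \<in> {\<sigma>\<in>T. k \<sigma> = k \<tau>}"
    then have \<sigma>: "\<sigma> \<in> T" "k \<sigma> = k \<tau>" by auto
    then have "equivalent (c \<sigma>) (c \<tau>)" using \<tau> by (simp add: k_eq_iff)
    then have "\<sigma> \<in> inst (c \<tau>) K" using \<sigma>(1) \<tau> by (simp add: inst_iff_arrow equivalent_def)
    moreover have False if \<rho>: "\<rho> \<in> T" "\<sigma> \<in> inst (c \<rho>) K" "(k \<rho>, k \<tau>) \<in> A" for \<rho>
    proof -
      have "(k \<rho>, k \<sigma>) \<in> Q" using \<rho>(3) \<sigma>(2) by (simp add: A_eq)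
      then have "arrow (c \<sigma>) (c \<rho>)" "k \<rho> \<noteq> k \<sigma>"
        using \<rho>(1) \<sigma>(1) by (simp_all add: Q_k_iff inst_iff_arrow)
      moreover have "arrow (c \<rho>) (c \<sigma>)" using \<rho>(1,2) \<sigma>(1) by (simp add: inst_iff_arrow)
      ultimately show False using \<rho>(1) \<sigma>(1) by (simp add: k_eq_iff equivalent_def)
    qed
    ultimately show "\<sigma> \<in> inst (c \<tau>) K - {\<sigma>. \<exists>\<rho>\<in>T. \<sigma> \<in> inst (c \<rho>) K \<and> (k \<rho>, k \<tau>) \<in> A}"
      by blast
  qed
  finally show ?thesis .
qed

lemma direct_instances_nodes: "direct_instances sg K A ` N = (\<lambda>\<tau>. {\<sigma>\<in>T. k \<sigma> = k \<tau>}) ` T"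
proof -
  have "direct_instances sg K A ` N = direct_instances sg K A ` k ` T" by (rule arg_cong[OF N_eq])
  also have "\<dots> = (\<lambda>\<tau>. {\<sigma>\<in>T. k \<sigma> = k \<tau>}) ` T"
    unfolding image_image by (intro image_cong direct_instances_eq refl)
  finally show ?thesis .
qed

lemma partition: "partition_on T (direct_instances sg K A ` N)"
  unfolding direct_instances_nodes partition_on_def disjoint_def by auto

text \<open>A partition of \<open>T\<close> by the image alone would allow two nodes to share a
  block; this excludes it.\<close>

lemma disjoint: "disjoint_family_on (direct_instances sg K A) N"
  unfolding disjoint_family_on_def
proof (intro ballI impI)
  fix X Y assume "X \<in> N" "Y \<in> N" "X \<noteq> Y"
  then obtain \<sigma> \<tau> where "\<sigma> \<in> T" "\<tau> \<in> T" "X = k \<sigma>" "Y = k \<tau>" "k \<sigma> \<noteq> k \<tau>"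
    unfolding N_eq by blast
  then show "direct_instances sg K A X \<inter> direct_instances sg K A Y = {}"
    by (auto simp: direct_instances_eq)
qed

section \<open>The source node and the smallest definable unit\<close>

lemma sources: "sources N A = {iso_class sg (core_char sg U K)}"
proof -
  obtain \<upsilon> where \<upsilon>: "\<upsilon> \<in> U" "\<upsilon> \<in> T" "c \<upsilon> = core_char sg U K" by (rule U_tuple)
  \<comment> \<open>Every core has \<upsilon> as an instance, so \<open>k \<upsilon>\<close> is the
    least node: all others have an incoming arc, and it has none.\<close>
  have top: "\<upsilon> \<in> inst (c \<tau>) K" if "\<tau> \<in> T" for \<tau>
    using U_subset_inst[OF that] \<upsilon>(1) by blast
  have "k \<tau> \<in> sources N A \<longleftrightarrow> k \<tau> = k \<upsilon>" if \<tau>: "\<tau> \<in> T" for \<tau>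
  proof
    assume src: "k \<tau> \<in> sources N A"
    show "k \<tau> = k \<upsilon>"
    proof (rule ccontr)
      assume "k \<tau> \<noteq> k \<upsilon>"
      then have "(k \<upsilon>, k \<tau>) \<in> Q" using \<tau> \<upsilon>(2) top by (simp add: Q_k_iff)
      then obtain Z where "(Z, k \<tau>) \<in> A"
        using finite_acyclic_cover[OF finite_Q acyclic_Q trans_Q] unfolding A_eq by metis
      with src show False unfolding sources_def by blast
    qed
  next
    assume eq: "k \<tau> = k \<upsilon>"
    have False if "(X, k \<tau>) \<in> A" for X
    proof -
      have X: "(X, k \<upsilon>) \<in> Q" using that eq by (simp add: A_eq)
      then have "X \<in> N" using Q_subset by blast
      then obtain \<rho> where \<rho>: "\<rho> \<in> T" "X = k \<rho>" unfolding N_eq by blast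
      then have "arrow (c \<upsilon>) (c \<rho>)" "k \<rho> \<noteq> k \<upsilon>" using X \<upsilon>(2) by (simp_all add: Q_k_iff inst_iff_arrow)
      moreover have "arrow (c \<rho>) (c \<upsilon>)" using top[OF \<rho>(1)] \<rho>(1) \<upsilon>(2) by (simp add: inst_iff_arrow)
      ultimately show False using \<rho>(1) \<upsilon>(2) by (simp add: k_eq_iff equivalent_def)
    qed
    then show "k \<tau> \<in> sources N A" using k_in_N[OF \<tau>] by (auto simp: sources_def)
  qed
  moreover have "sources N A \<subseteq> k ` T" unfolding sources_def using N_eq by blast
  ultimately have "sources N A = {k \<upsilon>}" using \<upsilon>(2) by blast
  then show ?thesis by (simp add: \<upsilon>(3))
qed

text \<open>Nothing is removed at a source, so all instances of the core of \<open>U\<close> remain.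
  They form a definable unit, and any explanation defining a unit that contains \<open>U\<close>
  maps to \<open>can U K\<close>, so that unit contains them.\<close>

lemma direct_instances_source:
  "direct_instances sg K A (iso_class sg (core_char sg U K)) = ess sg U K"
proof -
  interpret l: listed_K_unit sg K n U by (rule listed_U)
  obtain \<upsilon> where \<upsilon>: "\<upsilon> \<in> U" "\<upsilon> \<in> T" "c \<upsilon> = core_char sg U K" by (rule U_tuple)
  let ?I = "inst (core_char sg U K) K"
  have "{X. (X, iso_class sg (core_char sg U K)) \<in> A} = {}"
    using sources by (auto simp: sources_def)
  then have "direct_instances sg K A (iso_class sg (core_char sg U K)) = ?I"
    using inst_some[OF \<upsilon>(2)] unfolding direct_instances_def \<upsilon>(3) by auto
  moreover have "?I \<in> ex_units sg U K"
  proof -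
    have sub: "U \<subseteq> ?I" unfolding l.inst_core_char by (rule l.can_interprets)
    have sub_T: "?I \<subseteq> T" using inst_subset_T[OF \<upsilon>(2)] unfolding \<upsilon>(3) .
    have "is_unit n ?I"
    proof (rule is_unit_mono[OF _ sub])
      show "is_unit n U" using unit by (simp add: is_K_unit_def)
      show "finite ?I" using sub_T finite_T by (rule finite_subset)
      show "length \<tau> = n" if "\<tau> \<in> ?I" for \<tau> using subsetD[OF sub_T that] by (simp add: tuples_def)
    qed
    \<comment> \<open>The canonical formula is the witness: it is nearly connected by construction
      and has the same instances as its core.\<close>
    moreover have "defines_unit sg K (can U K) ?I"
      using l.can_NXL by (simp add: defines_unit_def interprets_def l.inst_core_char)
    ultimately show ?thesis using sub unfolding ex_units_def definable_def by blast
  qed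
  moreover have "?I \<subseteq> U'" if "U' \<in> ex_units sg U K" for U'
  proof -
    from that obtain \<phi> where \<phi>: "\<phi> \<in> NXL sg" "U \<subseteq> inst \<phi> K" "inst \<phi> K = U'"
      unfolding ex_units_def definable_def defines_unit_def interprets_def by blast
    then show ?thesis
      using arrow_inst_antimono[OF l.interprets_arrow_can[OF \<phi>(1,2)], of K]
      by (simp add: l.inst_core_char)
  qed
  ultimately show ?thesis unfolding ess_def by blast
qed

end

theorem theorem2:
  fixes sg :: signature and D :: dataset and sel :: selector
    and n :: nat and U T :: "ctuple set"
    and N :: "formula set set" and A :: "(formula set \<times> formula set) set"
    and \<delta> :: "formula set \<Rightarrow> ctuple set"
  assumes "is_signature sg"
    and "is_skb sg (D, sel)"
    and "is_K_unit (D, sel) n U"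
    and "T = tuples n D"
    and "expansion_graph sg n U (D, sel) = (N, A, \<delta>)"
  shows "directed_acyclic_graph N A \<and>
    (partition_on T (\<delta> ` N) \<and> disjoint_family_on \<delta> N) \<and>
    sources N A = {iso_class sg (core_char sg U (D, sel))} \<and>
    \<delta> (iso_class sg (core_char sg U (D, sel))) = ess sg U (D, sel)"
proof -
  interpret e: expansion sg "(D, sel)" n U
    using assms(2,3) by (rule expansion.intro)
  have N: "N = eg_nodes sg n U (D, sel)" and A: "A = eg_arcs sg N"
    and \<delta>: "\<delta> = direct_instances sg (D, sel) A"
    using assms(5) by (auto simp: expansion_graph_def Let_def)
  show ?thesis
    using e.dag e.partition e.disjoint e.sources e.direct_instances_source
    unfolding N A \<delta> assms(4) by simp
qed

end
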